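(* Let $L$ be a finite-dimensional logical system and $A=A_1\otimes\cdots\otimes A_n$ a finite-dimensional physical system, and let $\mathcal{E}(\cdot)=V(\cdot)V^\dagger$ be an encoding given by an isometry $V:L\to A$. Let $T_L$ be a Hermitian operator on $L$ and let $T_A=\sum_{i=1}^n T_i$, where each $T_i$ is a Hermitian operator acting only on $A_i$. Assume the code is covariant with zero charge offset, i.e. $[T_A,VV^\dagger]=0$ and $V^\dagger T_A V=T_L$ (equivalently $T_AV=VT_L$), and assume that for each $i$ the maximal and minimal eigenvalues of $T_i$ are equal in magnitude. Let $\mathcal{N}$ be the noise channel that erases a subsystem chosen uniformly at random, with a record of which one: $\mathcal{N}(\cdot)=\sum_{i=1}^n \frac1n\,|i\rangle\langle i|_C\otimes|\phi_i\rangle\langle\phi_i|_{A_i}\otimes \operatorname{tr}_{A_i}(\cdot)$ for fixed states $|\phi_i\rangle$. Then $$\epsilon_{\mathrm{worst}}(\mathcal{N}\circ\mathcal{E})\geq \frac{1}{2n}\,\frac{\Delta T_L}{\max_i \Delta T_i},$$ where for a Hermitian operator $T$, $\Delta T$ denotes the difference between its maximal and minimal eigenvalues.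
   Context: Fidelity: $F(\rho,\sigma)=\|\sqrt\rho\sqrt\sigma\|_1$. For channels $\mathcal{K},\mathcal{K}'$ with input $L$ and a pure state $|\phi\rangle_{LR}$ (any reference system $R$), $F_{|\phi\rangle}(\mathcal{K},\mathcal{K}')=F((\mathcal{K}\otimes\mathrm{id}_R)(\phi_{LR}),(\mathcal{K}'\otimes\mathrm{id}_R)(\phi_{LR}))$. For a channel $\mathcal{M}$ from $L$ to a system $B$, $f_{\mathrm{worst}}(\mathcal{M})=\max_{\mathcal{R}}\min_{|\phi\rangle}F_{|\phi\rangle}(\mathcal{R}\circ\mathcal{M},\mathrm{id}_L)$, where $\mathcal{R}$ ranges over quantum channels $B\to L$ (recovery maps) and $|\phi\rangle$ over pure states of $L$ and a reference system; $\epsilon_{\mathrm{worst}}(\mathcal{M})=\sqrt{1-f_{\mathrm{worst}}^2(\mathcal{M})}$. *)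

theory Defs
  imports "Jordan_Normal_Form.Schur_Decomposition" "Jordan_Normal_Form.Char_Poly"
begin

(* Conventions: all operators are complex matrices (Jordan_Normal_Form), a system of
   dimension d is C^d, X^dagger = mat_adjoint X. *)

definition hermitian_mat :: "complex mat \<Rightarrow> bool" where
  "hermitian_mat T \<longleftrightarrow> T \<in> carrier_mat (dim_row T) (dim_row T) \<and> mat_adjoint T = T"

definition psd_mat :: "complex mat \<Rightarrow> bool" where
  "psd_mat B \<longleftrightarrow> hermitian_mat B \<and>
     (\<forall>v \<in> carrier_vec (dim_row B). 0 \<le> Re ((B *\<^sub>v v) \<bullet>c v))"

definition mtrace :: "complex mat \<Rightarrow> complex" where
  "mtrace A = (\<Sum>i<dim_row A. A $$ (i, i))"

definition mat_sqrt :: "complex mat \<Rightarrow> complex mat" where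
  "mat_sqrt A = (THE B. B \<in> carrier_mat (dim_row A) (dim_row A) \<and> psd_mat B \<and> B * B = A)"

definition trace_norm :: "complex mat \<Rightarrow> real" where
  "trace_norm X = Re (mtrace (mat_sqrt (mat_adjoint X * X)))"

definition fidelity :: "complex mat \<Rightarrow> complex mat \<Rightarrow> real" where
  "fidelity \<rho> \<sigma> = trace_norm (mat_sqrt \<rho> * mat_sqrt \<sigma>)"

definition msum :: "nat \<Rightarrow> complex mat list \<Rightarrow> complex mat" where
  "msum d Ms = foldr (+) Ms (0\<^sub>m d d)"

(* quantum channel (CPTP map) from a din-dimensional to a dout-dimensional system,
   in Kraus form; it is a map on all din x din matrices *)
definition is_channel :: "nat \<Rightarrow> nat \<Rightarrow> (complex mat \<Rightarrow> complex mat) \<Rightarrow> bool" where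
  "is_channel din dout \<Phi> \<longleftrightarrow>
     (\<exists>Ks. set Ks \<subseteq> carrier_mat dout din \<and>
        msum din (map (\<lambda>K. mat_adjoint K * K) Ks) = 1\<^sub>m din \<and>
        (\<forall>X \<in> carrier_mat din din.
           \<Phi> X = msum dout (map (\<lambda>K. K * X * mat_adjoint K) Ks)))"

(* (Phi \<otimes> id_R) for a reference system of dimension dR; composite system R \<otimes> S with
   index r * d + s (blocks indexed by R). din = input dim, dout = output dim of Phi. *)
definition tensor_id :: "nat \<Rightarrow> nat \<Rightarrow> nat \<Rightarrow> (complex mat \<Rightarrow> complex mat) \<Rightarrow> complex mat \<Rightarrow> complex mat" where
  "tensor_id din dout dR \<Phi> X = mat (dR * dout) (dR * dout) (\<lambda>(a, b).
      \<Phi> (mat din din (\<lambda>(i, j). X $$ ((a div dout) * din + i, (b div dout) * din + j)))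
        $$ (a mod dout, b mod dout))"

definition proj :: "complex vec \<Rightarrow> complex mat" where
  "proj v = mat (dim_vec v) (dim_vec v) (\<lambda>(i, j). v $ i * cnj (v $ j))"

definition unit_vec_set :: "nat \<Rightarrow> complex vec set" where
  "unit_vec_set d = {v \<in> carrier_vec d. v \<bullet>c v = 1}"

definition ent_fidelity :: "nat \<Rightarrow> nat \<Rightarrow> (complex mat \<Rightarrow> complex mat) \<Rightarrow> (complex mat \<Rightarrow> complex mat)
     \<Rightarrow> complex vec \<Rightarrow> real" where
  "ent_fidelity dL dR K K' \<phi> =
     fidelity (tensor_id dL dL dR K (proj \<phi>)) (tensor_id dL dL dR K' (proj \<phi>))"

definition f_worst :: "nat \<Rightarrow> nat \<Rightarrow> (complex mat \<Rightarrow> complex mat) \<Rightarrow> real" where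
  "f_worst dL dB M = (SUP R \<in> {R. is_channel dB dL R}.
      INF p \<in> {(dR, \<phi>). 0 < dR \<and> \<phi> \<in> unit_vec_set (dR * dL)}.
        ent_fidelity dL (fst p) (R \<circ> M) id (snd p))"

definition eps_worst :: "nat \<Rightarrow> nat \<Rightarrow> (complex mat \<Rightarrow> complex mat) \<Rightarrow> real" where
  "eps_worst dL dB M = sqrt (1 - (f_worst dL dB M)\<^sup>2)"

(* Multi-partite system A = A_0 \<otimes> ... \<otimes> A_{n-1}, dims d 0, ..., d (n-1);
   mixed-radix indexing with subsystem 0 least significant. *)
definition stride :: "(nat \<Rightarrow> nat) \<Rightarrow> nat \<Rightarrow> nat" where
  "stride d j = (\<Prod>k<j. d k)"

definition digit :: "(nat \<Rightarrow> nat) \<Rightarrow> nat \<Rightarrow> nat \<Rightarrow> nat" where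
  "digit d j x = (x div stride d j) mod d j"

definition set_digit :: "(nat \<Rightarrow> nat) \<Rightarrow> nat \<Rightarrow> nat \<Rightarrow> nat \<Rightarrow> nat" where
  "set_digit d j x v = x - digit d j x * stride d j + v * stride d j"

definition total_dim :: "nat \<Rightarrow> (nat \<Rightarrow> nat) \<Rightarrow> nat" where
  "total_dim n d = (\<Prod>k<n. d k)"

(* operator T acting only on A_i: I \<otimes> ... \<otimes> T \<otimes> ... \<otimes> I *)
definition embed_local :: "nat \<Rightarrow> (nat \<Rightarrow> nat) \<Rightarrow> nat \<Rightarrow> complex mat \<Rightarrow> complex mat" where
  "embed_local n d i T = mat (total_dim n d) (total_dim n d) (\<lambda>(a, b).
      if (\<forall>j<n. j \<noteq> i \<longrightarrow> digit d j a = digit d j b) then T $$ (digit d i a, digit d i b) else 0)"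

(* |phi_i><phi_i|_{A_i} \<otimes> tr_{A_i}(X) *)
definition replace_sub :: "nat \<Rightarrow> (nat \<Rightarrow> nat) \<Rightarrow> nat \<Rightarrow> complex vec \<Rightarrow> complex mat \<Rightarrow> complex mat" where
  "replace_sub n d i \<phi> X = mat (total_dim n d) (total_dim n d) (\<lambda>(a, b).
      \<phi> $ (digit d i a) * cnj (\<phi> $ (digit d i b)) *
      (\<Sum>k<d i. X $$ (set_digit d i a k, set_digit d i b k)))"

(* erasure channel N, output system C \<otimes> A (C of dim n, index c * dim A + a):
   N(X) = sum_i 1/n |i><i|_C \<otimes> |phi_i><phi_i|_{A_i} \<otimes> tr_{A_i}(X) *)
definition erasure_channel :: "nat \<Rightarrow> (nat \<Rightarrow> nat) \<Rightarrow> (nat \<Rightarrow> complex vec) \<Rightarrow> complex mat \<Rightarrow> complex mat" where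
  "erasure_channel n d \<phi>s X = mat (n * total_dim n d) (n * total_dim n d) (\<lambda>(a, b).
      if a div total_dim n d = b div total_dim n d
      then (1 / of_nat n) * replace_sub n d (a div total_dim n d) (\<phi>s (a div total_dim n d)) X
              $$ (a mod total_dim n d, b mod total_dim n d)
      else 0)"

definition encoding :: "complex mat \<Rightarrow> complex mat \<Rightarrow> complex mat" where
  "encoding V X = V * X * mat_adjoint V"

definition max_eig :: "complex mat \<Rightarrow> real" where
  "max_eig T = Max (Re ` {e. eigenvalue T e})"

definition min_eig :: "complex mat \<Rightarrow> real" where
  "min_eig T = Min (Re ` {e. eigenvalue T e})"

definition spread :: "complex mat \<Rightarrow> real" where
  "spread T = max_eig T - min_eig T"

end

theory Submission
  imports Defs "Jordan_Normal_Form.Spectral_Radius"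
begin

text \<open>
  Fix a recovery map and feed in \<open>(|0\<rangle> x\<^sub>1 + |1\<rangle> x\<^sub>2) / \<surd>2\<close>, where \<open>x\<^sub>1, x\<^sub>2\<close> are unit eigenvectors of the logical charge
  for its largest and smallest eigenvalue. The squared fidelity \<open>h\<close> with the input is the squared norm of the averaged
  environment amplitude \<open>w = (\<langle>x\<^sub>1, \<Psi>\<^sub>1\<rangle> + \<langle>x\<^sub>2, \<Psi>\<^sub>2\<rangle>) / 2\<close>, where \<open>\<Psi>\<^sub>1, \<Psi>\<^sub>2\<close> are the purified outputs. The erased subsystem is handed
  to the environment, so the environment observable \<open>\<Sum>\<^sub>i |i\<rangle>\<langle>i| \<otimes> T\<^sub>i\<close> has expectations in \<open>\<Psi>\<^sub>1\<close> and \<open>\<Psi>\<^sub>2\<close> that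
  differ by \<open>\<Delta>T\<^sub>L / n\<close>. Its expectations in \<open>x\<^sub>1 \<otimes> w\<close> and \<open>x\<^sub>2 \<otimes> w\<close> agree, and these vectors are at total squared distance
  \<open>2 (1 - h)\<close> from \<open>\<Psi>\<^sub>1, \<Psi>\<^sub>2\<close>. Centring every \<open>T\<^sub>i\<close> makes its norm \<open>\<Delta>T\<^sub>i / 2\<close>, and Cauchy-Schwarz, in the weighted AM-GM form with a
  free parameter \<open>t\<close>, gives \<open>\<Delta>T\<^sub>L / n \<le> 2 max\<^sub>i \<Delta>T\<^sub>i \<surd>(1 - h)\<close>.
\<close>

section \<open>Hermitian and positive semidefinite matrices\<close>

text \<open>The recovery is arbitrary, so all that may enter is that its stacked Kraus operators
  form an isometry. Its ancilla is handed to the environment, and the observable ignores that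
  ancilla, so the expectations are those of the state before recovery. There each \<open>T i\<close>
  is weighted by \<open>1/n\<close>, and covariance turns the weighted sum into the logical charge
  divided by \<open>n\<close>. Centring is harmless because every subsystem is lost with the same
  probability for each input, so both expectations shift equally.

  The AM-GM form suits an environment that is a direct sum of blocks of different dimensions
  \<open>d i\<close>: a bound linear in squared norms adds up over blocks, and \<open>t\<close> is
  chosen once at the end. The squared distances total \<open>2 * (1 - h)\<close> and the squared
  norms of the sums at most 8, whence \<open>t * (1 - h) + 4 / t\<close>, with infimum
  \<open>4 * sqrt (1 - h)\<close>; a centred norm of half the spread leaves the factor 2.

  Fidelity rests on a definite description of the matrix square root, so existence and uniqueness of
  positive roots must come before any computation with it.\<close>

definition ip :: "nat \<Rightarrow> (nat \<Rightarrow> complex) \<Rightarrow> (nat \<Rightarrow> complex) \<Rightarrow> complex" where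
  "ip n x y = (\<Sum>a<n. cnj (x a) * y a)"

text \<open>As for \<open>ip\<close>, vectors are functions of which only the first \<open>n\<close>
  values count, so that a slice of a larger vector is a vector without any carrier condition.
  Conjugation sits on the first argument, unlike in \<open>\<bullet>c\<close>.\<close>

definition form :: "nat \<Rightarrow> complex mat \<Rightarrow> (nat \<Rightarrow> complex) \<Rightarrow> (nat \<Rightarrow> complex) \<Rightarrow> complex" where
  "form n T x y = (\<Sum>a<n. \<Sum>b<n. cnj (x a) * T $$ (a, b) * y b)"

lemma ip_cnj: "cnj (ip n x y) = ip n y x"
  by (simp add: ip_def mult.commute)

lemma ip_self: "ip n x x = of_real (\<Sum>a<n. (cmod (x a))\<^sup>2)"
  by (simp add: ip_def complex_norm_square mult.commute del: of_real_power)

lemma ip_self_nonneg: "Re (ip n x x) \<ge> 0"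
  by (simp add: ip_self sum_nonneg)

lemma mat_adjoint_dim [simp]:
  "dim_row (mat_adjoint A) = dim_col A" "dim_col (mat_adjoint A) = dim_row A"
  by (auto simp: mat_adjoint_def)

lemma mat_adjoint_index [simp]:
  fixes A :: "complex mat"
  assumes "i < dim_col A" "j < dim_row A"
  shows "mat_adjoint A $$ (i, j) = cnj (A $$ (j, i))"
  using assms by (simp add: mat_adjoint_def mat_of_rows_def)

lemma mult_mat_index:
  assumes "A \<in> carrier_mat n m" "B \<in> carrier_mat m k" "i < n" "j < k"
  shows "(A * B) $$ (i, j) = (\<Sum>l<m. A $$ (i, l) * B $$ (l, j))"
  using assms by (auto simp: scalar_prod_def atLeast0LessThan intro!: sum.cong)

lemma mult_mat_vec_index:
  assumes "A \<in> carrier_mat n m" "v \<in> carrier_vec m" "i < n"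
  shows "(A *\<^sub>v v) $ i = (\<Sum>l<m. A $$ (i, l) * v $ l)"
  using assms by (auto simp: scalar_prod_def atLeast0LessThan intro!: sum.cong)

lemma hermitian_mat_iff:
  assumes "T \<in> carrier_mat n n"
  shows "hermitian_mat T \<longleftrightarrow> (\<forall>a<n. \<forall>b<n. T $$ (a, b) = cnj (T $$ (b, a)))"
proof
  assume "hermitian_mat T"
  then have eq: "mat_adjoint T = T" by (simp add: hermitian_mat_def)
  show "\<forall>a<n. \<forall>b<n. T $$ (a, b) = cnj (T $$ (b, a))"
  proof (intro allI impI)
    fix a b assume "a < n" "b < n"
    then have "mat_adjoint T $$ (a, b) = cnj (T $$ (b, a))" using assms by simp
    then show "T $$ (a, b) = cnj (T $$ (b, a))" unfolding eq .
  qed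
next
  assume h: "\<forall>a<n. \<forall>b<n. T $$ (a, b) = cnj (T $$ (b, a))"
  have "mat_adjoint T $$ (a, b) = T $$ (a, b)" if "a < n" "b < n" for a b
    unfolding h[rule_format, OF that] using that assms by simp
  then have "mat_adjoint T = T"
    using assms by (intro eq_matI) auto
  then show "hermitian_mat T" using assms by (simp add: hermitian_mat_def)
qed

lemma hermitian_matD:
  assumes "T \<in> carrier_mat n n" "hermitian_mat T" "a < n" "b < n"
  shows "T $$ (a, b) = cnj (T $$ (b, a))"
  using assms hermitian_mat_iff by blast

lemma conj_scalar_prod_mat_vec:
  assumes "T \<in> carrier_mat n n" "v \<in> carrier_vec n"
  shows "(T *\<^sub>v v) \<bullet>c v = form n T (vec_index v) (vec_index v)"
proof -
  have "(T *\<^sub>v v) \<bullet>c v = (\<Sum>a<n. (T *\<^sub>v v) $ a * cnj (v $ a))"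
    using assms by (simp add: scalar_prod_def atLeast0LessThan)
  also have "\<dots> = form n T (vec_index v) (vec_index v)"
    unfolding form_def using mult_mat_vec_index[OF assms]
    by (auto simp: sum_distrib_left sum_distrib_right mult_ac intro!: sum.cong)
  finally show ?thesis .
qed

lemma form_cong:
  assumes "\<And>a. a < n \<Longrightarrow> x a = x' a" "\<And>a. a < n \<Longrightarrow> y a = y' a"
  shows "form n T x y = form n T x' y'"
  unfolding form_def using assms by (auto intro!: sum.cong)

lemma psd_mat_iff:
  assumes T: "T \<in> carrier_mat n n"
  shows "psd_mat T \<longleftrightarrow> hermitian_mat T \<and> (\<forall>x. 0 \<le> Re (form n T x x))"
proof -
  have "(\<forall>v\<in>carrier_vec n. 0 \<le> Re ((T *\<^sub>v v) \<bullet>c v)) \<longleftrightarrow> (\<forall>x. 0 \<le> Re (form n T x x))"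
  proof safe
    fix x assume *: "\<forall>v\<in>carrier_vec n. 0 \<le> Re ((T *\<^sub>v v) \<bullet>c v)"
    have "form n T x x = form n T (vec_index (vec n x)) (vec_index (vec n x))"
      by (rule form_cong) auto
    then show "0 \<le> Re (form n T x x)"
      using * conj_scalar_prod_mat_vec[OF T, of "vec n x"] by (auto dest: bspec[of _ _ "vec n x"])
  qed (use conj_scalar_prod_mat_vec[OF T] in auto)
  then show ?thesis using T by (simp add: psd_mat_def)
qed

lemma form_hermitian:
  assumes T: "T \<in> carrier_mat n n" "hermitian_mat T"
  shows "cnj (form n T x y) = form n T y x"
proof -
  have "cnj (form n T x y) = (\<Sum>a<n. \<Sum>b<n. x a * cnj (T $$ (a, b)) * cnj (y b))"
    by (simp add: form_def)
  also have "\<dots> = (\<Sum>a<n. \<Sum>b<n. x a * T $$ (b, a) * cnj (y b))"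
    using hermitian_matD[OF T] by (intro sum.cong refl) (metis complex_cnj_cnj lessThan_iff)
  also have "\<dots> = form n T y x"
    unfolding form_def by (subst sum.swap) (simp add: mult_ac)
  finally show ?thesis .
qed

section \<open>The spectral theorem for Hermitian matrices\<close>

lemma eigenvalue_hermitian_unit:
  assumes T: "T \<in> carrier_mat n n" "hermitian_mat T" and e: "eigenvalue T e"
  shows "Im e = 0"
    and "\<exists>x. ip n x x = 1 \<and> (\<forall>a<n. (\<Sum>b<n. T $$ (a, b) * x b) = e * x a)"
proof -
  obtain v where v: "v \<in> carrier_vec n" "v \<noteq> 0\<^sub>v n" "T *\<^sub>v v = e \<cdot>\<^sub>v v"
    using e T by (auto simp: eigenvalue_def eigenvector_def)
  define x where "x = vec_index v"
  have ev: "(\<Sum>b<n. T $$ (a, b) * x b) = e * x a" if "a < n" for a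
    using mult_mat_vec_index[OF T(1) v(1) that] v that by (simp add: x_def)
  define r where "r = (\<Sum>a<n. (cmod (x a))\<^sup>2)"
  have r: "ip n x x = of_real r" by (simp add: ip_self r_def)
  obtain i where i: "i < n" "x i \<noteq> 0"
    using v by (metis x_def carrier_vecD eq_vecI index_zero_vec)
  have "r > 0"
    unfolding r_def using i by (intro sum_pos2[of _ i]) auto
  have "form n T x x = (\<Sum>a<n. cnj (x a) * (\<Sum>b<n. T $$ (a, b) * x b))"
    by (simp add: form_def sum_distrib_left mult.assoc)
  also have "\<dots> = (\<Sum>a<n. cnj (x a) * (e * x a))"
    using ev by (intro sum.cong) auto
  also have "\<dots> = e * ip n x x"
    by (simp add: ip_def sum_distrib_left mult_ac)
  finally have "form n T x x = e * of_real r" by (simp add: r)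
  then have "cnj e * of_real r = e * of_real r"
    using form_hermitian[OF T, of x x] by simp
  then have "cnj e = e" using \<open>r > 0\<close> by simp
  then show "Im e = 0" by (simp add: complex_eq_iff)
  define c where "c = complex_of_real (1 / sqrt r)"
  define y where "y a = c * x a" for a
  have "ip n y y = (cnj c * c) * ip n x x"
    unfolding ip_def y_def sum_distrib_left by (intro sum.cong) auto
  moreover have "cnj c * c = 1 / of_real r"
  proof -
    have "cnj c * c = of_real ((1 / sqrt r) * (1 / sqrt r))"
      unfolding c_def of_real_mult by simp
    then show ?thesis using \<open>r > 0\<close> by simp
  qed
  ultimately have "ip n y y = 1" using \<open>r > 0\<close> r by simp
  moreover have "(\<Sum>b<n. T $$ (a, b) * y b) = e * y a" if "a < n" for a
  proof -
    have "(\<Sum>b<n. T $$ (a, b) * y b) = c * (\<Sum>b<n. T $$ (a, b) * x b)"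
      unfolding y_def sum_distrib_left by (intro sum.cong) auto
    then show ?thesis using ev[OF that] by (simp add: y_def)
  qed
  ultimately show "\<exists>x. ip n x x = 1 \<and> (\<forall>a<n. (\<Sum>b<n. T $$ (a, b) * x b) = e * x a)"
    by (intro exI[of _ y]) simp
qed

lemma mtrace_mult_comm:
  assumes "A \<in> carrier_mat n m" "B \<in> carrier_mat m n"
  shows "mtrace (A * B) = mtrace (B * A)"
proof -
  have "mtrace (A * B) = (\<Sum>i<n. \<Sum>l<m. A $$ (i, l) * B $$ (l, i))"
    using assms unfolding mtrace_def by (intro sum.cong) (auto simp: mult_mat_index simp del: index_mult_mat(1))
  also have "\<dots> = (\<Sum>l<m. \<Sum>i<n. B $$ (l, i) * A $$ (i, l))"
    by (subst sum.swap) (simp add: mult.commute)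
  also have "\<dots> = mtrace (B * A)"
    using assms unfolding mtrace_def by (intro sum.cong) (auto simp: mult_mat_index simp del: index_mult_mat(1))
  finally show ?thesis .
qed

text \<open>The trace of \<open>N\<^sup>2\<close> is the sum of the squared eigenvalues (Schur form) and also the sum of the
  squared moduli of the entries.\<close>

lemma hermitian_eigenvalues_zero:
  assumes N: "N \<in> carrier_mat n n" "hermitian_mat N" and z: "\<And>e. eigenvalue N e \<Longrightarrow> e = 0"
  shows "N = 0\<^sub>m n n"
proof -
  obtain as where as: "char_poly N = (\<Prod>a\<leftarrow>as. [:- a, 1:])"
    using char_poly_factorized[OF N(1)] by blast
  obtain B where B: "B \<in> carrier_mat n n" "upper_triangular B" "similar_mat N B"
    using schur_decomposition_exists[OF N(1) as] by blast
  obtain P Q where "similar_mat_wit N B P Q" using B(3) by (auto simp: similar_mat_def)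
  note w = similar_mat_witD2[OF N(1) this]
  have diag: "B $$ (i, i) = 0" if "i < n" for i
  proof -
    have "char_poly N = (\<Prod>a\<leftarrow>diag_mat B. [:- a, 1:])"
      using char_poly_similar[OF B(3)] char_poly_upper_triangular[OF B(1,2)] by simp
    moreover have "B $$ (i, i) \<in> set (diag_mat B)"
      using that B by (auto simp: diag_mat_def)
    ultimately have "poly (char_poly N) (B $$ (i, i)) = 0"
      by (auto simp: poly_prod_list prod_list_zero_iff o_def image_iff)
    then show ?thesis using z eigenvalue_root_char_poly[OF N(1)] by blast
  qed
  have ut: "B $$ (i, j) = 0" if "j < i" "i < n" for i j
    using B that by (auto simp: upper_triangular_def)
  \<comment> \<open>Moving \<open>P\<close> to the other end under the trace lets
    \<open>Q * P\<close> cancel, so the trace of \<open>N * N\<close> is that of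
    \<open>B * B\<close>.\<close>
  have "N * N = P * (B * Q * P * B * Q)"
    unfolding w(3) using w(4-7) by (simp add: assoc_mult_mat[of _ n n _ n _ n])
  also have "B * Q * P * B * Q = B * B * Q"
    using w(2,4-7) by (simp add: assoc_mult_mat[of _ n n _ n _ n])
  finally have "mtrace (N * N) = mtrace (B * B * Q * P)"
    using mtrace_mult_comm[of P n n "B * B * Q"] w(4-7) by simp
  also have "B * B * Q * P = B * B"
    using w(2,4-7) by (simp add: assoc_mult_mat[of _ n n _ n _ n])
  also have "mtrace (B * B) = (\<Sum>i<n. \<Sum>l<n. B $$ (i, l) * B $$ (l, i))"
    unfolding mtrace_def using B(1) by (intro sum.cong) (auto simp: mult_mat_index simp del: index_mult_mat(1))
  also have "\<dots> = 0"
  proof (intro sum.neutral ballI)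
    \<comment> \<open>Each product pairs an entry with its transposed one: off the diagonal one of
      the two lies below it, and on the diagonal stand eigenvalues of \<open>N\<close>.\<close>
    fix i l assume "i \<in> {..<n}" "l \<in> {..<n}"
    then show "B $$ (i, l) * B $$ (l, i) = 0"
      using ut[of i l] ut[of l i] diag[of i] by (cases i l rule: linorder_cases) auto
  qed
  finally have t0: "mtrace (N * N) = 0" .
  have "mtrace (N * N) = (\<Sum>i<n. \<Sum>l<n. N $$ (i, l) * N $$ (l, i))"
    unfolding mtrace_def using N(1) by (intro sum.cong) (auto simp: mult_mat_index simp del: index_mult_mat(1))
  also have "\<dots> = (\<Sum>i<n. \<Sum>l<n. of_real ((cmod (N $$ (i, l)))\<^sup>2))"
  proof (intro sum.cong refl)
    fix i l assume "i \<in> {..<n}" "l \<in> {..<n}"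
    then have "N $$ (l, i) = cnj (N $$ (i, l))" using hermitian_matD[OF N] by blast
    then show "N $$ (i, l) * N $$ (l, i) = of_real ((cmod (N $$ (i, l)))\<^sup>2)"
      by (simp add: complex_norm_square del: of_real_power)
  qed
  also have "\<dots> = of_real (\<Sum>i<n. \<Sum>l<n. (cmod (N $$ (i, l)))\<^sup>2)" by simp
  finally have "complex_of_real (\<Sum>i<n. \<Sum>l<n. (cmod (N $$ (i, l)))\<^sup>2) = 0"
    using t0 by simp
  then have "(\<Sum>i<n. \<Sum>l<n. (cmod (N $$ (i, l)))\<^sup>2) = 0"
    unfolding of_real_eq_0_iff .
  then have "\<forall>i<n. \<forall>l<n. N $$ (i, l) = 0"
    by (simp add: sum_nonneg sum_nonneg_eq_0_iff)
  then show ?thesis using N by (intro eq_matI) auto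
qed

lemma form_rank_one_sum:
  assumes "\<And>a b. a < n \<Longrightarrow> b < n \<Longrightarrow> T $$ (a, b) = (\<Sum>j\<in>J. c j * u j a * cnj (u j b))"
  shows "form n T x y = (\<Sum>j\<in>J. c j * ip n x (u j) * ip n (u j) y)"
proof -
  have "form n T x y = (\<Sum>a<n. \<Sum>b<n. \<Sum>j\<in>J. c j * (cnj (x a) * u j a) * (cnj (u j b) * y b))"
    unfolding form_def using assms
    by (intro sum.cong refl) (simp add: sum_distrib_left sum_distrib_right mult_ac)
  also have "\<dots> = (\<Sum>a<n. \<Sum>j\<in>J. \<Sum>b<n. c j * (cnj (x a) * u j a) * (cnj (u j b) * y b))"
    by (intro sum.cong refl sum.swap)
  also have "\<dots> = (\<Sum>j\<in>J. \<Sum>a<n. \<Sum>b<n. c j * (cnj (x a) * u j a) * (cnj (u j b) * y b))"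
    by (rule sum.swap)
  also have "\<dots> = (\<Sum>j\<in>J. c j * ip n x (u j) * ip n (u j) y)"
    unfolding ip_def mult.assoc sum_product by (simp add: sum_distrib_left mult.assoc)
  finally show ?thesis .
qed

text \<open>Each term contributes \<open>c j\<close> times a squared modulus to the quadratic form.
  Square roots, projections, Gram matrices and channel outputs all get their positivity from
  here.\<close>

lemma psd_rank_one_sum:
  assumes T: "T \<in> carrier_mat n n" and c: "\<And>j. j \<in> J \<Longrightarrow> c j \<ge> 0"
    and e: "\<And>a b. a < n \<Longrightarrow> b < n \<Longrightarrow> T $$ (a, b) = (\<Sum>j\<in>J. of_real (c j) * u j a * cnj (u j b))"
  shows "psd_mat T"
  unfolding psd_mat_iff[OF T]
proof (intro conjI allI)
  show "hermitian_mat T"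
    unfolding hermitian_mat_iff[OF T] by (simp add: e mult_ac)
  fix x
  have "form n T x x = (\<Sum>j\<in>J. of_real (c j) * ip n x (u j) * cnj (ip n x (u j)))"
    using form_rank_one_sum[OF e, where x = x and y = x] by (simp add: ip_cnj)
  also have "\<dots> = (\<Sum>j\<in>J. of_real (c j * (cmod (ip n x (u j)))\<^sup>2))"
    by (simp add: complex_norm_square mult.assoc del: of_real_power)
  finally show "0 \<le> Re (form n T x x)" using c by (simp add: sum_nonneg)
qed

text \<open>Bessel's inequality for every standard basis vector: the residual \<open>w\<close> of
  \<open>e\<close> after projection onto the family has squared norm \<open>1 - s\<close>. Summing
  the \<open>s\<close> over all coordinates gives \<open>m\<close>. The bound is what makes a
  maximal family exist in the deflation argument.\<close>

lemma orthonormal_card_le: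
  assumes on: "\<And>i j. i < m \<Longrightarrow> j < m \<Longrightarrow> ip n (u i) (u j) = (if i = j then 1 else 0)"
  shows "m \<le> n"
proof -
  have b: "(\<Sum>j<m. (cmod (u j a))\<^sup>2) \<le> 1" if a: "a < n" for a
  proof -
    define s where "s = (\<Sum>j<m. (cmod (u j a))\<^sup>2)"
    have s: "(\<Sum>j<m. cnj (u j a) * u j a) = of_real s"
      by (simp add: s_def complex_norm_square mult.commute del: of_real_power)
    define e where "e b = (if b = a then 1 else 0 :: complex)" for b
    define w where "w b = e b - (\<Sum>j<m. cnj (u j a) * u j b)" for b
    have ew: "ip n e w = 1 - of_real s"
    proof -
      have "ip n e w = (\<Sum>b<n. if b = a then w a else 0)"
        unfolding ip_def by (intro sum.cong) (auto simp: e_def)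
      then show ?thesis using a s by (simp add: w_def e_def)
    qed
    have uw: "ip n (u i) w = 0" if i: "i < m" for i
    proof -
      have "ip n (u i) w = (\<Sum>b<n. cnj (u i b) * e b) - (\<Sum>b<n. \<Sum>j<m. cnj (u j a) * (cnj (u i b) * u j b))"
        by (simp add: ip_def w_def right_diff_distrib sum_subtractf sum_distrib_left mult_ac)
      also have "(\<Sum>b<n. \<Sum>j<m. cnj (u j a) * (cnj (u i b) * u j b)) = (\<Sum>j<m. cnj (u j a) * ip n (u i) (u j))"
        by (subst sum.swap) (simp add: ip_def sum_distrib_left)
      also have "\<dots> = (\<Sum>j<m. if j = i then cnj (u i a) else 0)"
        using on i by (intro sum.cong) auto
      finally show ?thesis using i a by (simp add: e_def if_distrib cong: if_cong)
    qed
    have cw: "cnj (w b) = cnj (e b) - (\<Sum>j<m. u j a * cnj (u j b))" for b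
      by (simp add: w_def)
    have "ip n w w = ip n e w - (\<Sum>b<n. \<Sum>j<m. u j a * (cnj (u j b) * w b))"
      by (simp add: ip_def cw right_diff_distrib left_diff_distrib sum_subtractf sum_distrib_left sum_distrib_right mult_ac)
    also have "(\<Sum>b<n. \<Sum>j<m. u j a * (cnj (u j b) * w b)) = (\<Sum>j<m. u j a * ip n (u j) w)"
      by (subst sum.swap) (simp add: ip_def sum_distrib_left)
    finally have "ip n w w = 1 - of_real s" using uw ew by simp
    then show ?thesis using ip_self_nonneg[of n w] by (simp add: s_def)
  qed
  have "real m = (\<Sum>j<m. Re (ip n (u j) (u j)))" using on by simp
  also have "\<dots> = (\<Sum>j<m. \<Sum>a<n. (cmod (u j a))\<^sup>2)" by (simp add: ip_self)
  also have "\<dots> = (\<Sum>a<n. \<Sum>j<m. (cmod (u j a))\<^sup>2)" by (rule sum.swap)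
  also have "\<dots> \<le> (\<Sum>a<n. 1)" using b by (intro sum_mono) auto
  finally show ?thesis by simp
qed

text \<open>Deflation: a maximal orthonormal family of eigenvectors with nonzero eigenvalues leaves a
  remainder without nonzero eigenvalues.\<close>

lemma hermitian_spectral_decomposition:
  assumes T: "T \<in> carrier_mat n n" "hermitian_mat T"
  obtains m :: nat and u :: "nat \<Rightarrow> nat \<Rightarrow> complex" and c :: "nat \<Rightarrow> real" where
    "\<And>i j. i < m \<Longrightarrow> j < m \<Longrightarrow> ip n (u i) (u j) = (if i = j then 1 else 0)"
    "\<And>a b. a < n \<Longrightarrow> b < n \<Longrightarrow> T $$ (a, b) = (\<Sum>j<m. of_real (c j) * u j a * cnj (u j b))"
    "\<And>j. j < m \<Longrightarrow> (\<forall>a<n. (\<Sum>b<n. T $$ (a, b) * u j b) = of_real (c j) * u j a)"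
proof -
  define P where "P m u c \<longleftrightarrow>
      (\<forall>i<m. \<forall>j<m. ip n (u i) (u j) = (if i = j then 1 else 0)) \<and>
      (\<forall>j<m. \<forall>a<n. (\<Sum>b<n. T $$ (a, b) * u j b) = of_real (c j) * u j a)"
    for m and u :: "nat \<Rightarrow> nat \<Rightarrow> complex" and c :: "nat \<Rightarrow> real"
  define Q where "Q m \<longleftrightarrow> (\<exists>u c. P m u c)" for m
  have "Q 0" by (simp add: Q_def P_def)
  moreover have "\<forall>m. Q m \<longrightarrow> m \<le> n"
    unfolding Q_def P_def by (metis orthonormal_card_le)
  ultimately obtain m where m: "Q m" "\<And>k. Q k \<Longrightarrow> k \<le> m"
    using Nat.ex_has_greatest_nat[of Q 0 n] by auto
  then obtain u c where uc: "P m u c" by (auto simp: Q_def)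
  have on: "ip n (u i) (u j) = (if i = j then 1 else 0)" if "i < m" "j < m" for i j
    using uc that by (simp add: P_def)
  have ev: "(\<Sum>b<n. T $$ (a, b) * u j b) = of_real (c j) * u j a" if "j < m" "a < n" for j a
    using uc that by (simp add: P_def)
  \<comment> \<open>\<open>R\<close> is the part of \<open>T\<close> accounted for by the family.
    The remainder \<open>S\<close> is Hermitian and annihilates every \<open>u j\<close>, which
    forces its other eigenvectors to be orthogonal to them.\<close>
  define R where "R = mat n n (\<lambda>(a, b). \<Sum>j<m. of_real (c j) * u j a * cnj (u j b))"
  define S where "S = mat n n (\<lambda>(a, b). T $$ (a, b) - R $$ (a, b))"
  have S: "S \<in> carrier_mat n n" by (simp add: S_def)
  have Sh: "hermitian_mat S"
    unfolding hermitian_mat_iff[OF S]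
  proof (intro allI impI)
    fix a b assume "a < n" "b < n"
    then show "S $$ (a, b) = cnj (S $$ (b, a))"
      using hermitian_matD[OF T, of a b] by (simp add: S_def R_def mult_ac)
  qed
  have SR: "(\<Sum>b<n. S $$ (a, b) * x b) = (\<Sum>b<n. T $$ (a, b) * x b) - (\<Sum>j<m. of_real (c j) * u j a * ip n (u j) x)"
    if "a < n" for a x
  proof -
    have "(\<Sum>b<n. S $$ (a, b) * x b) = (\<Sum>b<n. T $$ (a, b) * x b)
        - (\<Sum>b<n. \<Sum>j<m. of_real (c j) * u j a * (cnj (u j b) * x b))"
      using that by (simp add: S_def R_def left_diff_distrib right_diff_distrib sum_subtractf sum_distrib_left sum_distrib_right mult_ac)
    also have "(\<Sum>b<n. \<Sum>j<m. of_real (c j) * u j a * (cnj (u j b) * x b))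
        = (\<Sum>j<m. of_real (c j) * u j a * ip n (u j) x)"
      by (subst sum.swap) (simp add: ip_def sum_distrib_left)
    finally show ?thesis .
  qed
  have Su: "(\<Sum>b<n. S $$ (a, b) * u j b) = 0" if "j < m" "a < n" for j a
  proof -
    have "(\<Sum>i<m. of_real (c i) * u i a * ip n (u i) (u j)) = (\<Sum>i<m. if i = j then of_real (c i) * u i a else 0)"
      using on that by (intro sum.cong) auto
    then show ?thesis using SR[OF that(2)] ev[OF that] that by simp
  qed
  have "S = 0\<^sub>m n n"
  proof (rule hermitian_eigenvalues_zero[OF S Sh], rule ccontr)
    fix e assume e: "eigenvalue S e" "e \<noteq> 0"
    obtain x where x: "ip n x x = 1" "\<And>a. a < n \<Longrightarrow> (\<Sum>b<n. S $$ (a, b) * x b) = e * x a"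
      using eigenvalue_hermitian_unit(2)[OF S Sh e(1)] by auto
    have re: "of_real (Re e) = e"
      using eigenvalue_hermitian_unit(1)[OF S Sh e(1)] by (simp add: complex_eq_iff)
    have ux: "ip n (u j) x = 0" if "j < m" for j
    proof -
      have "e * ip n (u j) x = (\<Sum>a<n. cnj (u j a) * (e * x a))"
        by (simp add: ip_def sum_distrib_left mult_ac)
      also have "\<dots> = (\<Sum>a<n. cnj (u j a) * (\<Sum>b<n. S $$ (a, b) * x b))"
        using x(2) by (intro sum.cong) auto
      also have "\<dots> = form n S (u j) x"
        by (simp add: form_def sum_distrib_left mult.assoc)
      also have "\<dots> = cnj (form n S x (u j))" by (simp add: form_hermitian[OF S Sh])
      also have "form n S x (u j) = 0"
        using Su[OF that] by (simp add: form_def mult.assoc flip: sum_distrib_left)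
      finally show ?thesis using e by simp
    qed
    have xu: "ip n x (u j) = 0" if "j < m" for j
      using ux[OF that] ip_cnj[of n "u j" x] by simp
    \<comment> \<open>On vectors orthogonal to the family \<open>S\<close> and \<open>T\<close>
      agree, so \<open>x\<close> is an eigenvector of \<open>T\<close> and would enlarge a maximal
      family.\<close>
    have "P (Suc m) (u(m := x)) (c(m := Re e))"
      unfolding P_def using on ev x ux xu SR re by (auto simp: less_Suc_eq)
    then have "Suc m \<le> m" using m(2) unfolding Q_def by blast
    then show False by simp
  qed
  then have "T $$ (a, b) = (\<Sum>j<m. of_real (c j) * u j a * cnj (u j b))" if "a < n" "b < n" for a b
    using that by (metis (no_types, lifting) R_def S_def eq_iff_diff_eq_0 index_mat(1) index_zero_mat(1) old.prod.case)
  then show thesis using that[of m u c] on ev by blast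
qed

section \<open>Extremal eigenvalues and Rayleigh bounds\<close>

lemma eigenvalueI:
  assumes T: "T \<in> carrier_mat n n" and x: "ip n x x = 1"
    and ev: "\<And>a. a < n \<Longrightarrow> (\<Sum>b<n. T $$ (a, b) * x b) = e * x a"
  shows "eigenvalue T e"
proof -
  have "vec n x \<noteq> 0\<^sub>v n"
  proof
    assume "vec n x = 0\<^sub>v n"
    then have "x a = 0" if "a < n" for a using that by (metis index_vec index_zero_vec(1))
    then show False using x by (simp add: ip_def)
  qed
  moreover have "T *\<^sub>v vec n x = e \<cdot>\<^sub>v vec n x"
    using T ev by (intro eq_vecI) (simp_all add: scalar_prod_def atLeast0LessThan)
  ultimately show ?thesis
    using T by (auto simp: eigenvalue_def eigenvector_def intro!: exI[of _ "vec n x"])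
qed

lemma form_nonneg_of_eigenvalues:
  assumes T: "T \<in> carrier_mat n n" "hermitian_mat T"
    and pos: "\<And>e. eigenvalue T (of_real e) \<Longrightarrow> e \<ge> 0"
  shows "Re (form n T x x) \<ge> 0"
proof -
  obtain m :: nat and u c where on: "\<And>i j. i < m \<Longrightarrow> j < m \<Longrightarrow> ip n (u i) (u j) = (if i = j then 1 else 0)"
    and dec: "\<And>a b. a < n \<Longrightarrow> b < n \<Longrightarrow> T $$ (a, b) = (\<Sum>j<m. of_real (c j) * u j a * cnj (u j b))"
    and ev: "\<And>j. j < m \<Longrightarrow> (\<forall>a<n. (\<Sum>b<n. T $$ (a, b) * u j b) = of_real (c j) * u j a)"
    using hermitian_spectral_decomposition[OF T] by blast
  have "c j \<ge> 0" if "j < m" for j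
  proof -
    have "eigenvalue T (of_real (c j))"
      using eigenvalueI[OF T(1), of "u j"] on[OF that that] ev[OF that] by simp
    then show ?thesis by (rule pos)
  qed
  then have "psd_mat T"
    using dec by (intro psd_rank_one_sum[OF T(1), of "{..<m}" c u]) auto
  then show ?thesis using psd_mat_iff[OF T(1)] by simp
qed

lemma finite_eigenvalues:
  assumes "(T :: complex mat) \<in> carrier_mat n n"
  shows "finite {e. eigenvalue T e}"
  using card_finite_spectrum(1)[OF assms] by (simp add: spectrum_def)

lemma eigenvalues_nonempty:
  assumes "(T :: complex mat) \<in> carrier_mat n n" "0 < n"
  shows "{e. eigenvalue T e} \<noteq> {}"
  using spectrum_non_empty[OF assms] by (simp add: spectrum_def)

lemma extremal_eigenvalues:
  assumes T: "T \<in> carrier_mat n n" "hermitian_mat T" and n: "0 < n"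
  shows "eigenvalue T (of_real (max_eig T))" "eigenvalue T (of_real (min_eig T))"
    "\<And>e. eigenvalue T (of_real e) \<Longrightarrow> min_eig T \<le> e \<and> e \<le> max_eig T"
proof -
  let ?E = "Re ` {e. eigenvalue T e}"
  have fin: "finite ?E" "?E \<noteq> {}"
    using finite_eigenvalues[OF T(1)] eigenvalues_nonempty[OF T(1) n] by auto
  have real: "eigenvalue T (of_real r)" if "r \<in> ?E" for r
  proof -
    from that obtain e where e: "eigenvalue T e" "r = Re e" by auto
    then have "of_real r = e"
      using eigenvalue_hermitian_unit(1)[OF T e(1)] by (simp add: complex_eq_iff)
    then show ?thesis using e by simp
  qed
  show "eigenvalue T (of_real (max_eig T))" "eigenvalue T (of_real (min_eig T))"
    unfolding max_eig_def min_eig_def using real Max_in[OF fin] Min_in[OF fin] by blast+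
  fix e assume "eigenvalue T (of_real e)"
  then have "e \<in> ?E" by force
  then show "min_eig T \<le> e \<and> e \<le> max_eig T"
    unfolding max_eig_def min_eig_def using fin by simp
qed

lemma spread_nonneg:
  assumes T: "T \<in> carrier_mat n n" "hermitian_mat T" and n: "0 < n"
  shows "spread T \<ge> 0"
  using extremal_eigenvalues[OF assms] by (fastforce simp: spread_def)

lemma extremal_eigenvector:
  assumes T: "T \<in> carrier_mat n n" "hermitian_mat T" and e: "eigenvalue T (of_real e)"
  obtains x where "ip n x x = 1" "form n T x x = of_real e"
proof -
  obtain x where x: "ip n x x = 1" "\<And>a. a < n \<Longrightarrow> (\<Sum>b<n. T $$ (a, b) * x b) = of_real e * x a"
    using eigenvalue_hermitian_unit(2)[OF T e] by auto
  have "form n T x x = (\<Sum>a<n. cnj (x a) * (\<Sum>b<n. T $$ (a, b) * x b))"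
    by (simp add: form_def sum_distrib_left mult.assoc)
  also have "\<dots> = (\<Sum>a<n. cnj (x a) * (of_real e * x a))"
    using x(2) by (intro sum.cong) auto
  also have "\<dots> = of_real e * ip n x x"
    by (simp add: ip_def sum_distrib_left mult_ac)
  finally show thesis using that[of x] x by simp
qed

lemma form_one: "form n (1\<^sub>m n) x y = ip n x y"
proof -
  have "form n (1\<^sub>m n) x y = (\<Sum>a<n. \<Sum>b<n. if b = a then cnj (x a) * y a else 0)"
    unfolding form_def by (intro sum.cong refl) auto
  then show ?thesis by (simp add: ip_def)
qed

lemma form_affine:
  assumes "T \<in> carrier_mat n n"
  shows "form n (a \<cdot>\<^sub>m T + b \<cdot>\<^sub>m 1\<^sub>m n) x y = a * form n T x y + b * ip n x y"
proof -
  have "form n (a \<cdot>\<^sub>m T + b \<cdot>\<^sub>m 1\<^sub>m n) x y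
      = (\<Sum>i<n. \<Sum>j<n. a * (cnj (x i) * T $$ (i, j) * y j) + (if j = i then b * (cnj (x i) * y i) else 0))"
    unfolding form_def using assms by (intro sum.cong refl) (auto simp: algebra_simps)
  also have "\<dots> = a * form n T x y + b * ip n x y"
    by (simp add: sum.distrib form_def ip_def sum_distrib_left)
  finally show ?thesis .
qed

lemma affine_eigen:
  fixes T :: "complex mat"
  assumes T: "T \<in> carrier_mat n n" and i: "i < n"
  shows "(\<Sum>j<n. (a \<cdot>\<^sub>m T + b \<cdot>\<^sub>m 1\<^sub>m n) $$ (i, j) * x j) = a * (\<Sum>j<n. T $$ (i, j) * x j) + b * x i"
proof -
  have "(\<Sum>j<n. (a \<cdot>\<^sub>m T + b \<cdot>\<^sub>m 1\<^sub>m n) $$ (i, j) * x j)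
     = (\<Sum>j<n. a * (T $$ (i, j) * x j) + (if j = i then b * x i else 0))"
    using assms by (intro sum.cong refl) (auto simp: distrib_right mult.assoc)
  also have "\<dots> = a * (\<Sum>j<n. T $$ (i, j) * x j) + b * x i"
    using i by (simp add: sum.distrib sum_distrib_left)
  finally show ?thesis .
qed

lemma hermitian_affine:
  assumes T: "T \<in> carrier_mat n n" "hermitian_mat T"
  shows "hermitian_mat (of_real a \<cdot>\<^sub>m T + of_real b \<cdot>\<^sub>m 1\<^sub>m n)"
proof -
  have c: "of_real a \<cdot>\<^sub>m T + of_real b \<cdot>\<^sub>m 1\<^sub>m n \<in> carrier_mat n n" using T by simp
  show ?thesis
    unfolding hermitian_mat_iff[OF c]
  proof (intro allI impI)
    fix i j assume ij: "i < n" "j < n"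
    show "(of_real a \<cdot>\<^sub>m T + of_real b \<cdot>\<^sub>m 1\<^sub>m n) $$ (i, j) = cnj ((of_real a \<cdot>\<^sub>m T + of_real b \<cdot>\<^sub>m 1\<^sub>m n) $$ (j, i))"
      using hermitian_matD[OF T ij] T ij by simp
  qed
qed

lemma eigenvalue_affine:
  assumes T: "T \<in> carrier_mat n n" "hermitian_mat T" and a: "a \<noteq> 0"
    and e: "eigenvalue (of_real a \<cdot>\<^sub>m T + of_real b \<cdot>\<^sub>m 1\<^sub>m n) (of_real e)"
  shows "eigenvalue T (of_real ((e - b) / a))"
proof -
  let ?S = "of_real a \<cdot>\<^sub>m T + of_real b \<cdot>\<^sub>m 1\<^sub>m n"
  have S: "?S \<in> carrier_mat n n" using T by simp
  obtain x where x: "ip n x x = 1" "\<And>i. i < n \<Longrightarrow> (\<Sum>j<n. ?S $$ (i, j) * x j) = of_real e * x i"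
    using eigenvalue_hermitian_unit(2)[OF S hermitian_affine[OF T] e] by auto
  show ?thesis
  proof (rule eigenvalueI[OF T(1) x(1)])
    fix i assume i: "i < n"
    have "of_real a * (\<Sum>j<n. T $$ (i, j) * x j) + of_real b * x i = of_real e * x i"
      using x(2)[OF i] unfolding affine_eigen[OF T(1) i] .
    then show "(\<Sum>j<n. T $$ (i, j) * x j) = of_real ((e - b) / a) * x i"
      using a by (simp add: field_simps)
  qed
qed

text \<open>Shift and reflect: \<open>T\<close> minus its least eigenvalue, and its largest
  eigenvalue minus \<open>T\<close>, have only nonnegative eigenvalues and hence nonnegative
  quadratic forms.\<close>

lemma rayleigh_bounds:
  assumes T: "T \<in> carrier_mat n n" "hermitian_mat T" and n: "0 < n"
  shows "min_eig T * Re (ip n x x) \<le> Re (form n T x x)"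
    and "Re (form n T x x) \<le> max_eig T * Re (ip n x x)"
proof -
  have 1: "0 \<le> Re (form n (of_real 1 \<cdot>\<^sub>m T + of_real (- min_eig T) \<cdot>\<^sub>m 1\<^sub>m n) x x)"
  proof (rule form_nonneg_of_eigenvalues[OF _ hermitian_affine[OF T]])
    fix e assume "eigenvalue (of_real 1 \<cdot>\<^sub>m T + of_real (- min_eig T) \<cdot>\<^sub>m 1\<^sub>m n) (complex_of_real e)"
    from eigenvalue_affine[OF T _ this] show "0 \<le> e"
      using extremal_eigenvalues(3)[OF T n, of "e + min_eig T"] by simp
  qed (use T in simp)
  have 2: "0 \<le> Re (form n (of_real (-1) \<cdot>\<^sub>m T + of_real (max_eig T) \<cdot>\<^sub>m 1\<^sub>m n) x x)"
  proof (rule form_nonneg_of_eigenvalues[OF _ hermitian_affine[OF T]])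
    fix e assume "eigenvalue (of_real (-1) \<cdot>\<^sub>m T + of_real (max_eig T) \<cdot>\<^sub>m 1\<^sub>m n) (complex_of_real e)"
    from eigenvalue_affine[OF T _ this] show "0 \<le> e"
      using extremal_eigenvalues(3)[OF T n, of "max_eig T - e"] by simp
  qed (use T in simp)
  from 1 show "min_eig T * Re (ip n x x) \<le> Re (form n T x x)"
    by (subst (asm) form_affine[OF T(1)]) simp
  from 2 show "Re (form n T x x) \<le> max_eig T * Re (ip n x x)"
    by (subst (asm) form_affine[OF T(1)]) simp
qed

section \<open>Positive square roots\<close>

lemma psd_sqrt_exists:
  assumes A: "A \<in> carrier_mat n n" "psd_mat A"
  shows "\<exists>B \<in> carrier_mat n n. psd_mat B \<and> B * B = A"
proof -
  have h: "hermitian_mat A" and nn: "\<And>x. 0 \<le> Re (form n A x x)"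
    using A psd_mat_iff by auto
  obtain m :: nat and u c where on: "\<And>i j. i < m \<Longrightarrow> j < m \<Longrightarrow> ip n (u i) (u j) = (if i = j then 1 else 0)"
    and dec: "\<And>a b. a < n \<Longrightarrow> b < n \<Longrightarrow> A $$ (a, b) = (\<Sum>j<m. of_real (c j) * u j a * cnj (u j b))"
    and ev: "\<And>j. j < m \<Longrightarrow> (\<forall>a<n. (\<Sum>b<n. A $$ (a, b) * u j b) = of_real (c j) * u j a)"
    using hermitian_spectral_decomposition[OF A(1) h] by blast
  have c: "c j \<ge> 0" if "j < m" for j
  proof -
    have "form n A (u j) (u j) = (\<Sum>i<m. of_real (c i) * ip n (u j) (u i) * ip n (u i) (u j))"
      by (rule form_rank_one_sum[OF dec])
    also have "\<dots> = (\<Sum>i<m. if i = j then of_real (c j) else 0)"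
      using on that by (intro sum.cong) auto
    also have "\<dots> = of_real (c j)" using that by simp
    finally show ?thesis using nn[of "u j"] by simp
  qed
  \<comment> \<open>Keep the eigenvectors and take roots of the eigenvalues; orthonormality removes
    the cross terms from \<open>B * B\<close>.\<close>
  define B where "B = mat n n (\<lambda>(a, b). \<Sum>j<m. of_real (sqrt (c j)) * u j a * cnj (u j b))"
  have B: "B \<in> carrier_mat n n" by (simp add: B_def)
  have Bab: "B $$ (a, b) = (\<Sum>j<m. of_real (sqrt (c j)) * u j a * cnj (u j b))" if "a < n" "b < n" for a b
    using that by (simp add: B_def)
  have "psd_mat B"
    using c Bab by (intro psd_rank_one_sum[OF B, of "{..<m}" "\<lambda>j. sqrt (c j)" u]) auto
  moreover have "B * B = A"
  proof (rule eq_matI)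
    fix a b assume "a < dim_row A" "b < dim_col A"
    then have ab: "a < n" "b < n" using A by auto
    have "(B * B) $$ (a, b) = (\<Sum>l<n. \<Sum>i<m. \<Sum>j<m. of_real (sqrt (c i)) * of_real (sqrt (c j)) * u i a * cnj (u j b) * (cnj (u i l) * u j l))"
      unfolding mult_mat_index[OF B B ab]
    proof (intro sum.cong refl)
      fix l assume "l \<in> {..<n}"
      then have "l < n" by simp
      show "B $$ (a, l) * B $$ (l, b) = (\<Sum>i<m. \<Sum>j<m. of_real (sqrt (c i)) * of_real (sqrt (c j)) * u i a * cnj (u j b) * (cnj (u i l) * u j l))"
        unfolding Bab[OF ab(1) \<open>l < n\<close>] Bab[OF \<open>l < n\<close> ab(2)] sum_product
        by (intro sum.cong refl) (simp add: mult_ac)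
    qed
    also have "\<dots> = (\<Sum>i<m. \<Sum>l<n. \<Sum>j<m. of_real (sqrt (c i)) * of_real (sqrt (c j)) * u i a * cnj (u j b) * (cnj (u i l) * u j l))"
      by (rule sum.swap)
    also have "\<dots> = (\<Sum>i<m. \<Sum>j<m. \<Sum>l<n. of_real (sqrt (c i)) * of_real (sqrt (c j)) * u i a * cnj (u j b) * (cnj (u i l) * u j l))"
      by (intro sum.cong refl sum.swap)
    also have "\<dots> = (\<Sum>i<m. \<Sum>j<m. of_real (sqrt (c i)) * of_real (sqrt (c j)) * u i a * cnj (u j b) * ip n (u i) (u j))"
      by (simp add: ip_def sum_distrib_left)
    also have "\<dots> = (\<Sum>i<m. \<Sum>j<m. if j = i then of_real (c i) * u i a * cnj (u i b) else 0)"
    proof (intro sum.cong refl)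
      fix i j assume "i \<in> {..<m}" "j \<in> {..<m}"
      moreover have "complex_of_real (sqrt (c i)) * of_real (sqrt (c i)) = of_real (c i)" if "i < m" for i
        using c[OF that] by (simp flip: of_real_mult)
      ultimately show "complex_of_real (sqrt (c i)) * of_real (sqrt (c j)) * u i a * cnj (u j b) * ip n (u i) (u j)
          = (if j = i then of_real (c i) * u i a * cnj (u i b) else 0)"
        using on by auto
    qed
    also have "\<dots> = A $$ (a, b)" using dec[OF ab] by simp
    finally show "(B * B) $$ (a, b) = A $$ (a, b)" .
  qed (use A B in auto)
  ultimately show ?thesis using B by blast
qed

lemma form_square:
  assumes M: "M \<in> carrier_mat n n" "hermitian_mat M"
  shows "form n (M * M) x x = ip n (\<lambda>l. \<Sum>k<n. M $$ (l, k) * x k) (\<lambda>l. \<Sum>k<n. M $$ (l, k) * x k)"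
proof -
  have "form n (M * M) x x = (\<Sum>i<n. \<Sum>k<n. \<Sum>l<n. cnj (M $$ (l, i) * x i) * (M $$ (l, k) * x k))"
    unfolding form_def
  proof (intro sum.cong refl)
    fix i k assume ik: "i \<in> {..<n}" "k \<in> {..<n}"
    have "cnj (x i) * (M * M) $$ (i, k) * x k = (\<Sum>l<n. cnj (x i) * (M $$ (i, l) * M $$ (l, k)) * x k)"
      using ik by (simp add: mult_mat_index[OF M(1) M(1)] sum_distrib_left sum_distrib_right del: index_mult_mat(1))
    also have "\<dots> = (\<Sum>l<n. cnj (M $$ (l, i) * x i) * (M $$ (l, k) * x k))"
    proof (intro sum.cong refl)
      fix l assume "l \<in> {..<n}"
      then have "M $$ (i, l) = cnj (M $$ (l, i))" using hermitian_matD[OF M] ik by blast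
      then show "cnj (x i) * (M $$ (i, l) * M $$ (l, k)) * x k = cnj (M $$ (l, i) * x i) * (M $$ (l, k) * x k)"
        by simp
    qed
    finally show "cnj (x i) * (M * M) $$ (i, k) * x k = (\<Sum>l<n. cnj (M $$ (l, i) * x i) * (M $$ (l, k) * x k))" .
  qed
  also have "\<dots> = (\<Sum>i<n. \<Sum>l<n. \<Sum>k<n. cnj (M $$ (l, i) * x i) * (M $$ (l, k) * x k))"
    by (intro sum.cong refl sum.swap)
  also have "\<dots> = (\<Sum>l<n. \<Sum>i<n. \<Sum>k<n. cnj (M $$ (l, i) * x i) * (M $$ (l, k) * x k))"
    by (rule sum.swap)
  also have "\<dots> = ip n (\<lambda>l. \<Sum>k<n. M $$ (l, k) * x k) (\<lambda>l. \<Sum>k<n. M $$ (l, k) * x k)"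
    by (simp add: ip_def sum_product)
  finally show ?thesis .
qed

text \<open>With \<open>D = B - C\<close> one has \<open>B\<^sup>2 - C\<^sup>2 = B D + D C\<close>; evaluated on an eigenvector \<open>x\<close> of \<open>D\<close> with
  eigenvalue \<open>e\<close> this gives \<open>e (\<langle>x, B x\<rangle> + \<langle>x, C x\<rangle>) = 0\<close>, which forces \<open>e = 0\<close>.\<close>

lemma psd_sqrt_unique:
  assumes B: "B \<in> carrier_mat n n" "psd_mat B" and C: "C \<in> carrier_mat n n" "psd_mat C"
    and eq: "B * B = C * C"
  shows "B = C"
proof -
  have hB: "hermitian_mat B" "\<And>x. 0 \<le> Re (form n B x x)" using B psd_mat_iff by auto
  have hC: "hermitian_mat C" "\<And>x. 0 \<le> Re (form n C x x)" using C psd_mat_iff by auto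
  define D where "D = mat n n (\<lambda>(a, b). B $$ (a, b) - C $$ (a, b))"
  have D: "D \<in> carrier_mat n n" by (simp add: D_def)
  have Dab: "D $$ (a, b) = B $$ (a, b) - C $$ (a, b)" if "a < n" "b < n" for a b
    using that by (simp add: D_def)
  have hD: "hermitian_mat D"
    unfolding hermitian_mat_iff[OF D]
  proof (intro allI impI)
    fix a b assume ab: "a < n" "b < n"
    show "D $$ (a, b) = cnj (D $$ (b, a))"
      using ab hermitian_matD[OF B(1) hB(1) ab] hermitian_matD[OF C(1) hC(1) ab] by (simp add: Dab)
  qed
  have "D = 0\<^sub>m n n"
  proof (rule hermitian_eigenvalues_zero[OF D hD], rule ccontr)
    fix e assume e: "eigenvalue D e" "e \<noteq> 0"
    obtain x where x: "ip n x x = 1" "\<And>a. a < n \<Longrightarrow> (\<Sum>b<n. D $$ (a, b) * x b) = e * x a"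
      using eigenvalue_hermitian_unit(2)[OF D hD e(1)] by auto
    have ce: "cnj e = e" using eigenvalue_hermitian_unit(1)[OF D hD e(1)] by (simp add: complex_eq_iff)
    define b where "b l = (\<Sum>k<n. B $$ (l, k) * x k)" for l
    define c where "c l = (\<Sum>k<n. C $$ (l, k) * x k)" for l
    have bc: "b l - c l = e * x l" if "l < n" for l
      using x(2)[OF that] that by (simp add: Dab b_def c_def left_diff_distrib sum_subtractf)
    have fB: "form n B x x = ip n x b"
      by (simp add: form_def ip_def b_def sum_distrib_left mult.assoc)
    have fC: "form n C x x = ip n x c"
      by (simp add: form_def ip_def c_def sum_distrib_left mult.assoc)
    have fC': "ip n c x = ip n x c" using form_hermitian[OF C(1) hC(1), of x x] ip_cnj[of n x c] fC by simp
    have "ip n b b - ip n c c = 0"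
      unfolding b_def[abs_def] c_def[abs_def]
      using form_square[OF B(1) hB(1), of x] form_square[OF C(1) hC(1), of x] eq by simp
    moreover have "ip n b b - ip n c c = (\<Sum>l<n. e * (cnj (x l) * b l) + e * (cnj (c l) * x l))"
      unfolding ip_def sum_subtractf[symmetric]
    proof (intro sum.cong refl)
      fix l assume "l \<in> {..<n}"
      then have b: "b l = c l + e * x l" using bc[of l] by (simp add: algebra_simps)
      show "cnj (b l) * b l - cnj (c l) * c l = e * (cnj (x l) * b l) + e * (cnj (c l) * x l)"
        unfolding b by (simp add: ce algebra_simps)
    qed
    ultimately have "e * (ip n x b + ip n c x) = 0"
      by (simp add: ip_def sum.distrib sum_distrib_left distrib_left)
    then have z: "form n B x x + form n C x x = 0" using e(2) by (simp add: fB fC fC')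
    have "Re (form n B x x) = 0" "Re (form n C x x) = 0"
      using arg_cong[OF z, of Re] hB(2)[of x] hC(2)[of x] by auto
    \<comment> \<open>The difference of the two forms is \<open>e\<close>, while both have just been
      shown to have real part zero.\<close>
    moreover have "ip n x b - ip n x c = (\<Sum>l<n. cnj (x l) * (e * x l))"
      unfolding ip_def sum_subtractf[symmetric] using bc by (intro sum.cong) (auto simp flip: right_diff_distrib)
    then have "form n B x x - form n C x x = e * ip n x x"
      unfolding fB fC by (simp add: ip_def sum_distrib_left mult_ac)
    then have "form n B x x - form n C x x = e" using x by simp
    ultimately have "Re e = 0" by (metis minus_complex.sel(1) diff_self)
    then show False using ce e(2) by (simp add: complex_eq_iff)
  qed
  then have "B $$ (a, b) = C $$ (a, b)" if "a < n" "b < n" for a b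
    using Dab[OF that] that by simp
  then show ?thesis using B C by (intro eq_matI) auto
qed

lemma mat_sqrt_eqI:
  assumes "B \<in> carrier_mat n n" "psd_mat B" "B * B = A"
  shows "mat_sqrt A = B"
  unfolding mat_sqrt_def
proof (rule the_equality)
  have "dim_row A = n" using assms by auto
  then show "B \<in> carrier_mat (dim_row A) (dim_row A) \<and> psd_mat B \<and> B * B = A" using assms by simp
  fix C assume "C \<in> carrier_mat (dim_row A) (dim_row A) \<and> psd_mat C \<and> C * C = A"
  then show "C = B" using psd_sqrt_unique[of C n B] assms \<open>dim_row A = n\<close> by simp
qed

lemma mat_sqrt_psd:
  assumes A: "A \<in> carrier_mat n n" "psd_mat A"
  shows "mat_sqrt A \<in> carrier_mat n n" "psd_mat (mat_sqrt A)" "mat_sqrt A * mat_sqrt A = A"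
  using psd_sqrt_exists[OF A] mat_sqrt_eqI by metis+

section \<open>Fidelity with a pure state\<close>

lemma proj_carrier: "v \<in> carrier_vec n \<Longrightarrow> proj v \<in> carrier_mat n n"
  by (simp add: proj_def)

lemma proj_index: "v \<in> carrier_vec n \<Longrightarrow> i < n \<Longrightarrow> j < n \<Longrightarrow> proj v $$ (i, j) = v $ i * cnj (v $ j)"
  by (simp add: proj_def)

text \<open>A projection is its own square, so only the factor needs a root. Used with
  \<open>c = 1\<close> for the pure state itself and with the overlap as \<open>c\<close> inside the
  trace norm.\<close>

lemma mat_sqrt_scaled_proj:
  assumes v: "v \<in> carrier_vec n" "ip n (vec_index v) (vec_index v) = 1" and c: "c \<ge> 0"
    and A: "A \<in> carrier_mat n n"
    and Aab: "\<And>a b. a < n \<Longrightarrow> b < n \<Longrightarrow> A $$ (a, b) = of_real c * v $ a * cnj (v $ b)"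
  shows "mat_sqrt A = of_real (sqrt c) \<cdot>\<^sub>m proj v"
proof (rule mat_sqrt_eqI)
  let ?B = "complex_of_real (sqrt c) \<cdot>\<^sub>m proj v"
  show B: "?B \<in> carrier_mat n n" using proj_carrier[OF v(1)] by simp
  have Bab: "?B $$ (a, b) = of_real (sqrt c) * v $ a * cnj (v $ b)" if "a < n" "b < n" for a b
    using that proj_carrier[OF v(1)] proj_index[OF v(1) that] by simp
  show "psd_mat ?B"
    using c Bab by (intro psd_rank_one_sum[OF B, of "{()}" "\<lambda>_. sqrt c" "\<lambda>_. vec_index v"]) auto
  show "?B * ?B = A"
  proof (rule eq_matI)
    fix a b assume "a < dim_row A" "b < dim_col A"
    then have ab: "a < n" "b < n" using A by auto
    have "(?B * ?B) $$ (a, b) = (\<Sum>l<n. of_real c * v $ a * cnj (v $ b) * (cnj (v $ l) * v $ l))"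
      unfolding mult_mat_index[OF B B ab]
    proof (intro sum.cong refl)
      fix l assume "l \<in> {..<n}"
      then have l: "l < n" by simp
      have "complex_of_real c = of_real (sqrt c) * of_real (sqrt c)"
        using c by (simp flip: of_real_mult)
      then show "?B $$ (a, l) * ?B $$ (l, b) = of_real c * v $ a * cnj (v $ b) * (cnj (v $ l) * v $ l)"
        unfolding Bab[OF ab(1) l] Bab[OF l ab(2)] by (simp add: mult_ac)
    qed
    also have "\<dots> = of_real c * v $ a * cnj (v $ b) * ip n (vec_index v) (vec_index v)"
      by (simp add: ip_def sum_distrib_left)
    finally show "(?B * ?B) $$ (a, b) = A $$ (a, b)" using v Aab[OF ab] by simp
  qed (use A B in auto)
qed

lemma mtrace_proj:
  assumes "v \<in> carrier_vec n"
  shows "mtrace (c \<cdot>\<^sub>m proj v) = c * ip n (vec_index v) (vec_index v)"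
  using assms by (simp add: mtrace_def proj_def ip_def sum_distrib_left mult_ac)

lemma gram_index:
  fixes X :: "complex mat"
  assumes X: "X \<in> carrier_mat m n" and "a < n" "b < n"
  shows "(mat_adjoint X * X) $$ (a, b) = (\<Sum>l<m. cnj (X $$ (l, a)) * X $$ (l, b))"
proof -
  have "mat_adjoint X \<in> carrier_mat n m" using X by auto
  from mult_mat_index[OF this X assms(2,3)] show ?thesis
    using X assms(2) by simp
qed

lemma mat_adjoint_carrier: "X \<in> carrier_mat m n \<Longrightarrow> mat_adjoint X \<in> carrier_mat n m"
  by auto

lemma gram_carrier: "X \<in> carrier_mat m n \<Longrightarrow> mat_adjoint X * X \<in> carrier_mat n n"
  by auto

lemma trace_norm_nonneg: "trace_norm X \<ge> 0"
proof -
  define n m where "n = dim_col X" and "m = dim_row X"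
  have X: "X \<in> carrier_mat m n" by (simp add: n_def m_def)
  let ?A = "mat_adjoint X * X"
  have A: "?A \<in> carrier_mat n n" using X by auto
  have "psd_mat ?A"
    by (rule psd_rank_one_sum[OF A, of "{..<m}" "\<lambda>_. 1" "\<lambda>l a. cnj (X $$ (l, a))"])
       (use gram_index[OF X] in auto)
  note B = mat_sqrt_psd[OF A this]
  \<comment> \<open>A diagonal entry is the quadratic form at a basis vector.\<close>
  have "0 \<le> Re (mat_sqrt ?A $$ (i, i))" if "i < n" for i
  proof -
    have "form n (mat_sqrt ?A) (\<lambda>a. if a = i then 1 else 0) (\<lambda>a. if a = i then 1 else 0) = mat_sqrt ?A $$ (i, i)"
    proof -
      have "form n (mat_sqrt ?A) (\<lambda>a. if a = i then 1 else 0) (\<lambda>a. if a = i then 1 else 0)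
        = (\<Sum>a<n. \<Sum>b<n. if b = i then (if a = i then mat_sqrt ?A $$ (a, b) else 0) else 0)"
        unfolding form_def by (intro sum.cong refl) auto
      then show ?thesis using that by simp
    qed
    then show ?thesis using B(1,2) psd_mat_iff by metis
  qed
  then show ?thesis
    using B(1) by (auto simp: trace_norm_def mtrace_def intro!: sum_nonneg)
qed

lemma fidelity_nonneg: "fidelity \<rho> \<sigma> \<ge> 0"
  by (simp add: fidelity_def trace_norm_nonneg)

text \<open>With \<open>s\<close> the root of \<open>\<rho>\<close> applied to \<open>v\<close>, the
  product of the two roots has rank one, with entries \<open>s l * cnj (v $ j)\<close>. Its Gram
  matrix is the squared norm of \<open>s\<close> times \<open>proj v\<close>, and that squared norm
  is the expectation of \<open>\<rho>\<close> in \<open>v\<close>.\<close>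

lemma fidelity_pure:
  assumes r: "\<rho> \<in> carrier_mat n n" "psd_mat \<rho>"
    and v: "v \<in> carrier_vec n" "ip n (vec_index v) (vec_index v) = 1"
  shows "fidelity \<rho> (proj v) = sqrt (Re (form n \<rho> (vec_index v) (vec_index v)))"
proof -
  note S = mat_sqrt_psd[OF r]
  have P: "proj v \<in> carrier_mat n n" by (rule proj_carrier[OF v(1)])
  have sP: "mat_sqrt (proj v) = proj v"
    using mat_sqrt_scaled_proj[OF v, of 1 "proj v"] P proj_index[OF v(1)] by auto
  define s where "s l = (\<Sum>k<n. mat_sqrt \<rho> $$ (l, k) * v $ k)" for l
  define c where "c = Re (form n \<rho> (vec_index v) (vec_index v))"
  have hS: "hermitian_mat (mat_sqrt \<rho>)" using S psd_mat_iff by auto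
  have "form n \<rho> (vec_index v) (vec_index v) = ip n s s"
    using form_square[OF S(1) hS, of "vec_index v"] S(3) by (simp add: s_def[abs_def])
  then have ss: "ip n s s = of_real c" "c \<ge> 0"
    by (simp_all add: c_def ip_self sum_nonneg)
  let ?X = "mat_sqrt \<rho> * proj v"
  have X: "?X \<in> carrier_mat n n" using S(1) P by simp
  have Xab: "?X $$ (l, j) = s l * cnj (v $ j)" if "l < n" "j < n" for l j
    unfolding mult_mat_index[OF S(1) P that] s_def sum_distrib_right
    using that proj_index[OF v(1)] by (intro sum.cong) auto
  have "mat_sqrt (mat_adjoint ?X * ?X) = of_real (sqrt c) \<cdot>\<^sub>m proj v"
  proof (rule mat_sqrt_scaled_proj[OF v ss(2)])
    show "mat_adjoint ?X * ?X \<in> carrier_mat n n" by (rule gram_carrier[OF X])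
    fix a b assume ab: "a < n" "b < n"
    have "(mat_adjoint ?X * ?X) $$ (a, b) = (\<Sum>l<n. v $ a * cnj (v $ b) * (cnj (s l) * s l))"
      unfolding gram_index[OF X ab] using Xab ab by (intro sum.cong) (auto simp del: index_mult_mat(1))
    also have "\<dots> = v $ a * cnj (v $ b) * ip n s s"
      by (simp add: ip_def sum_distrib_left)
    finally show "(mat_adjoint ?X * ?X) $$ (a, b) = of_real c * v $ a * cnj (v $ b)"
      using ss by (simp add: mult_ac)
  qed
  then have "fidelity \<rho> (proj v) = Re (mtrace (of_real (sqrt c) \<cdot>\<^sub>m proj v))"
    by (simp add: fidelity_def trace_norm_def sP)
  also have "\<dots> = sqrt c" using mtrace_proj[OF v(1)] v(2) by simp
  finally show ?thesis by (simp add: c_def)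
qed

section \<open>Block indices and Kraus representations\<close>

lemma sum_blocks:
  fixes f :: "nat \<Rightarrow> 'a :: comm_monoid_add"
  shows "(\<Sum>b<n * D. f b) = (\<Sum>c<n. \<Sum>a<D. f (c * D + a))"
proof -
  have "(\<Sum>b<n * D. f b) = (\<Sum>c<n. sum f {c * D..<c * D + D})"
    by (simp add: sum.nat_group)
  also have "\<dots> = (\<Sum>c<n. \<Sum>a<D. f (c * D + a))"
  proof (rule sum.cong[OF refl])
    fix c
    show "sum f {c * D..<c * D + D} = (\<Sum>a<D. f (c * D + a))"
      using sum.shift_bounds_nat_ivl[of f 0 "c * D" D] by (simp add: atLeast0LessThan add.commute)
  qed
  finally show ?thesis .
qed

lemma block_index_less: "c < n \<Longrightarrow> a < D \<Longrightarrow> c * D + a < n * (D :: nat)"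
proof -
  assume "c < n" "a < D"
  then have "c * D + a < Suc c * D" by simp
  also have "\<dots> \<le> n * D" using \<open>c < n\<close> by (intro mult_le_mono1) simp
  finally show ?thesis .
qed

text \<open>Each Kraus operator maps the pure input to the pure, unnormalised vector
  \<open>w j\<close>, the reference index being the quotient and the system index the remainder. The
  output is therefore a sum of rank-one matrices, ready for \<open>psd_rank_one_sum\<close> and
  \<open>form_rank_one_sum\<close>.\<close>

lemma tensor_id_kraus:
  assumes K: "\<And>X s s'. X \<in> carrier_mat din din \<Longrightarrow> s < dout \<Longrightarrow> s' < dout \<Longrightarrow>
      \<Phi> X $$ (s, s') = (\<Sum>j\<in>J. \<Sum>i<din. \<Sum>i'<din. K j s i * X $$ (i, i') * cnj (K j s' i'))"
    and v: "v \<in> carrier_vec (dR * din)"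
    and w: "\<And>j a. w j a = (\<Sum>i<din. K j (a mod dout) i * v $ (a div dout * din + i))"
    and ab: "a < dR * dout" "b < dR * dout"
  shows "tensor_id din dout dR \<Phi> (proj v) $$ (a, b) = (\<Sum>j\<in>J. w j a * cnj (w j b))"
proof -
  have dout: "dout > 0" using ab by (cases dout) auto
  have m: "a mod dout < dout" "b mod dout < dout" using dout by auto
  have q: "a div dout < dR" "b div dout < dR" using ab by (simp_all add: less_mult_imp_div_less)
  have "tensor_id din dout dR \<Phi> (proj v) $$ (a, b)
     = (\<Sum>j\<in>J. \<Sum>i<din. \<Sum>i'<din. K j (a mod dout) i * proj v $$ (a div dout * din + i, b div dout * din + i') * cnj (K j (b mod dout) i'))"
    using ab m by (simp add: tensor_id_def K)
  also have "\<dots> = (\<Sum>j\<in>J. \<Sum>i<din. \<Sum>i'<din. (K j (a mod dout) i * v $ (a div dout * din + i)) * cnj (K j (b mod dout) i' * v $ (b div dout * din + i')))"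
    using q by (intro sum.cong refl) (auto simp: proj_index[OF v] block_index_less)
  also have "\<dots> = (\<Sum>j\<in>J. w j a * cnj (w j b))"
    by (simp add: w sum_product)
  finally show ?thesis .
qed

lemma tensor_id_id:
  assumes v: "v \<in> carrier_vec (dR * dL)"
  shows "tensor_id dL dL dR id (proj v) = proj v"
proof (rule eq_matI)
  fix a b assume "a < dim_row (proj v)" "b < dim_col (proj v)"
  then have ab: "a < dR * dL" "b < dR * dL" using v by (auto simp: proj_def)
  then have "0 < dL" by (cases dL) auto
  then show "tensor_id dL dL dR id (proj v) $$ (a, b) = proj v $$ (a, b)"
    using ab by (simp add: tensor_id_def)
qed (use v in \<open>auto simp: tensor_id_def proj_def\<close>)

text \<open>The identity channel leaves a pure state, so the squared fidelity is the expectation of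
  the output in \<open>v\<close>, and each Kraus operator adds the squared modulus of its own
  expectation in \<open>v\<close>.\<close>

lemma ent_fidelity_kraus:
  assumes K: "\<And>X s s'. X \<in> carrier_mat dL dL \<Longrightarrow> s < dL \<Longrightarrow> s' < dL \<Longrightarrow>
      \<Phi> X $$ (s, s') = (\<Sum>j\<in>J. \<Sum>i<dL. \<Sum>i'<dL. K j s i * X $$ (i, i') * cnj (K j s' i'))"
    and v: "v \<in> carrier_vec (dR * dL)" "ip (dR * dL) (vec_index v) (vec_index v) = 1"
  shows "ent_fidelity dL dR \<Phi> id v = sqrt (\<Sum>j\<in>J. (cmod (\<Sum>r<dR. \<Sum>s<dL. cnj (v $ (r * dL + s)) *
            (\<Sum>i<dL. K j s i * v $ (r * dL + i))))\<^sup>2)"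
proof -
  define w where "w j a = (\<Sum>i<dL. K j (a mod dL) i * v $ (a div dL * dL + i))" for j a
  let ?r = "tensor_id dL dL dR \<Phi> (proj v)"
  have r: "?r \<in> carrier_mat (dR * dL) (dR * dL)" by (simp add: tensor_id_def)
  note rab = tensor_id_kraus[where K = K and w = w, OF K v(1) w_def]
  have psd: "psd_mat ?r"
    by (rule psd_rank_one_sum[OF r, of J "\<lambda>_. 1" w]) (use rab in auto)
  have ipw: "ip (dR * dL) (vec_index v) (w j) = (\<Sum>r<dR. \<Sum>s<dL. cnj (v $ (r * dL + s)) *
            (\<Sum>i<dL. K j s i * v $ (r * dL + i)))" for j
    unfolding ip_def sum_blocks by (intro sum.cong refl) (auto simp: w_def)
  have "form (dR * dL) ?r (vec_index v) (vec_index v)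
      = (\<Sum>j\<in>J. 1 * ip (dR * dL) (vec_index v) (w j) * ip (dR * dL) (w j) (vec_index v))"
    by (rule form_rank_one_sum) (use rab in simp)
  also have "\<dots> = (\<Sum>j\<in>J. of_real ((cmod (ip (dR * dL) (vec_index v) (w j)))\<^sup>2))"
    by (simp add: complex_norm_square ip_cnj del: of_real_power)
  finally show ?thesis
    unfolding ent_fidelity_def tensor_id_id[OF v(1)] fidelity_pure[OF r psd v]
    by (simp add: ipw)
qed

lemma msum_carrier: "set Ms \<subseteq> carrier_mat d d \<Longrightarrow> msum d Ms \<in> carrier_mat d d"
  by (induction Ms) (auto simp: msum_def)

lemma msum_index:
  assumes "set Ms \<subseteq> carrier_mat d d" "i < d" "j < d"
  shows "msum d Ms $$ (i, j) = (\<Sum>l<length Ms. (Ms ! l) $$ (i, j))"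
proof -
  have "msum d Ms $$ (i, j) = (\<Sum>M\<leftarrow>Ms. M $$ (i, j))"
    using assms(1)
  proof (induction Ms)
    case (Cons M Ms)
    then have "msum d Ms \<in> carrier_mat d d" by (simp add: msum_carrier)
    with Cons assms show ?case by (auto simp: msum_def)
  qed (use assms in \<open>simp add: msum_def\<close>)
  then show ?thesis by (simp add: sum_list_sum_nth atLeast0LessThan)
qed

lemma kraus_term_index:
  fixes K X :: "complex mat"
  assumes K: "K \<in> carrier_mat m n" and X: "X \<in> carrier_mat n n" and ij: "i < m" "j < m"
  shows "(K * X * mat_adjoint K) $$ (i, j) = (\<Sum>b<n. \<Sum>b'<n. K $$ (i, b) * X $$ (b, b') * cnj (K $$ (j, b')))"
proof -
  have KX: "K * X \<in> carrier_mat m n" using K X by simp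
  have Ka: "mat_adjoint K \<in> carrier_mat n m" using K by auto
  have "(K * X * mat_adjoint K) $$ (i, j) = (\<Sum>b'<n. (K * X) $$ (i, b') * cnj (K $$ (j, b')))"
    unfolding mult_mat_index[OF KX Ka ij] using K ij by (intro sum.cong) auto
  also have "\<dots> = (\<Sum>b'<n. \<Sum>b<n. K $$ (i, b) * X $$ (b, b') * cnj (K $$ (j, b')))"
    using ij by (intro sum.cong refl) (simp add: mult_mat_index[OF K X] sum_distrib_right del: index_mult_mat(1))
  also have "\<dots> = (\<Sum>b<n. \<Sum>b'<n. K $$ (i, b) * X $$ (b, b') * cnj (K $$ (j, b')))"
    by (rule sum.swap)
  finally show ?thesis .
qed

text \<open>Kraus operators become index functions. The first property says that stacking them over
  the pairs \<open>(l, s)\<close> gives orthonormal columns, which is the isometric dilation of the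
  channel.\<close>

lemma is_channelE:
  assumes "is_channel din dout \<Phi>"
  obtains m and K :: "nat \<Rightarrow> nat \<Rightarrow> nat \<Rightarrow> complex" where
    "\<And>b b'. b < din \<Longrightarrow> b' < din \<Longrightarrow> (\<Sum>l<m. \<Sum>s<dout. cnj (K l s b) * K l s b') = (if b = b' then 1 else 0)"
    "\<And>X s s'. X \<in> carrier_mat din din \<Longrightarrow> s < dout \<Longrightarrow> s' < dout \<Longrightarrow>
       \<Phi> X $$ (s, s') = (\<Sum>l<m. \<Sum>b<din. \<Sum>b'<din. K l s b * X $$ (b, b') * cnj (K l s' b'))"
proof -
  obtain Ks where Ks: "set Ks \<subseteq> carrier_mat dout din"
    "msum din (map (\<lambda>K. mat_adjoint K * K) Ks) = 1\<^sub>m din"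
    "\<And>X. X \<in> carrier_mat din din \<Longrightarrow> \<Phi> X = msum dout (map (\<lambda>K. K * X * mat_adjoint K) Ks)"
    using assms unfolding is_channel_def by auto
  have Kl: "Ks ! l \<in> carrier_mat dout din" if "l < length Ks" for l
    using Ks(1) that by auto
  define K where "K l s b = (Ks ! l) $$ (s, b)" for l s b
  show thesis
  proof (rule that)
    fix b b' assume b: "b < din" "b' < din"
    have "set (map (\<lambda>K. mat_adjoint K * K) Ks) \<subseteq> carrier_mat din din"
      using Ks(1) by (auto intro!: gram_carrier[of _ dout din])
    from msum_index[OF this b]
    have "(1\<^sub>m din :: complex mat) $$ (b, b') = (\<Sum>l<length Ks. (mat_adjoint (Ks ! l) * (Ks ! l)) $$ (b, b'))"
      unfolding Ks(2) by simp
    also have "\<dots> = (\<Sum>l<length Ks. \<Sum>s<dout. cnj (K l s b) * K l s b')"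
      unfolding K_def using gram_index[OF Kl b] by (intro sum.cong[OF refl]) simp
    finally show "(\<Sum>l<length Ks. \<Sum>s<dout. cnj (K l s b) * K l s b') = (if b = b' then 1 else 0)"
      using b by simp
  next
    fix X :: "complex mat" and s s' assume X: "X \<in> carrier_mat din din" and s: "s < dout" "s' < dout"
    have "set (map (\<lambda>K. K * X * mat_adjoint K) Ks) \<subseteq> carrier_mat dout dout"
      using Ks(1) X by (auto intro!: mult_carrier_mat[of _ dout din] mat_adjoint_carrier)
    from msum_index[OF this s]
    have "\<Phi> X $$ (s, s') = (\<Sum>l<length Ks. (Ks ! l * X * mat_adjoint (Ks ! l)) $$ (s, s'))"
      unfolding Ks(3)[OF X] by simp
    also have "\<dots> = (\<Sum>l<length Ks. \<Sum>b<din. \<Sum>b'<din. K l s b * X $$ (b, b') * cnj (K l s' b'))"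
      using Kl kraus_term_index[OF _ X s] by (intro sum.cong refl) (simp add: K_def del: index_mult_mat(1))
    finally show "\<Phi> X $$ (s, s') = (\<Sum>l<length Ks. \<Sum>b<din. \<Sum>b'<din. K l s b * X $$ (b, b') * cnj (K l s' b'))" .
  qed
qed

section \<open>Mixed-radix digits\<close>

lemma stride_Suc: "stride d (Suc j) = stride d j * d j"
  by (simp add: stride_def)

lemma total_dim_stride: "total_dim n d = stride d n"
  by (simp add: total_dim_def stride_def)

lemma stride_split:
  assumes "j \<le> k"
  shows "stride d k = stride d j * (\<Prod>l\<in>{j..<k}. d l)"
  using prod.atLeastLessThan_concat[of 0 j k d] assms
  by (simp add: stride_def atLeast0LessThan)

lemma stride_pos: "\<forall>i<n. 0 < d i \<Longrightarrow> j \<le> n \<Longrightarrow> 0 < stride d j"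
  by (auto simp: stride_def intro!: prod_pos)

lemma digit_less: "0 < d j \<Longrightarrow> digit d j x < d j"
  by (simp add: digit_def)

text \<open>Induction from the most significant digit: the remainder modulo \<open>?s\<close>
  retains all lower digits, and the quotient is the top one.\<close>

lemma mixed_radix_unique:
  assumes "a < stride d m" "b < stride d m" "\<And>j. j < m \<Longrightarrow> digit d j a = digit d j b"
  shows "a = b"
  using assms
proof (induction m arbitrary: a b)
  case 0
  then show ?case by (simp add: stride_def)
next
  case (Suc m)
  let ?s = "stride d m"
  have s: "?s > 0" using Suc.prems(1) by (cases "?s") (auto simp: stride_Suc)
  have dig: "digit d j (x mod ?s) = digit d j x" if "j < m" for j x
  proof -
    have "?s = stride d (Suc j) * (\<Prod>l\<in>{Suc j..<m}. d l)" using stride_split that by simp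
    then have "x mod ?s mod stride d (Suc j) = x mod stride d (Suc j)"
      by (simp add: mod_mod_cancel)
    then have "(x mod ?s mod stride d (Suc j)) div stride d j = (x mod stride d (Suc j)) div stride d j"
      by simp
    then show ?thesis
      unfolding digit_def stride_Suc mod_mult2_eq
      by (cases "stride d j = 0") simp_all
  qed
  have "a mod ?s = b mod ?s"
  proof (rule Suc.IH)
    show "a mod ?s < ?s" "b mod ?s < ?s" using s by simp_all
    show "digit d j (a mod ?s) = digit d j (b mod ?s)" if "j < m" for j
      using Suc.prems(3)[of j] that by (simp add: dig)
  qed
  moreover have "digit d m x = x div ?s" if "x < stride d (Suc m)" for x
    using that by (simp add: digit_def stride_Suc less_mult_imp_div_less mult.commute)
  then have "a div ?s = b div ?s" using Suc.prems by (metis lessI)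
  ultimately show ?case by (metis div_mult_mod_eq)
qed

text \<open>Separates the digits below \<open>i\<close>, the digit itself and those above; the
  truncated subtraction in \<open>set_digit\<close> disappears, since the subtracted amount is a
  summand of \<open>x\<close>.\<close>

lemma set_digit_decomp:
  "set_digit d i x v = x mod stride d i + stride d i * (v + d i * (x div stride d (Suc i)))"
proof -
  let ?s = "stride d i"
  have "x = x mod ?s + ?s * (x div ?s)" by simp
  also have "x div ?s = digit d i x + d i * (x div stride d (Suc i))"
    by (simp add: digit_def stride_Suc div_mult2_eq)
  finally have x: "x = x mod ?s + ?s * (digit d i x + d i * (x div stride d (Suc i)))" .
  have "x - digit d i x * ?s = x mod ?s + ?s * (d i * (x div stride d (Suc i)))"
    by (subst x) (simp add: algebra_simps)
  then show ?thesis by (simp add: set_digit_def algebra_simps)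
qed

context
  fixes n :: nat and d :: "nat \<Rightarrow> nat"
  assumes d_pos: "\<forall>i<n. 0 < d i"
begin

lemma set_digit_props:
  assumes i: "i < n" and v: "v < d i"
  shows "set_digit d i x v mod stride d i = x mod stride d i"
    "set_digit d i x v div stride d (Suc i) = x div stride d (Suc i)"
    "digit d i (set_digit d i x v) = v"
proof -
  have s: "0 < stride d i" using stride_pos[OF d_pos] i by simp
  show "set_digit d i x v mod stride d i = x mod stride d i"
    unfolding set_digit_decomp by simp
  have q: "set_digit d i x v div stride d i = v + d i * (x div stride d (Suc i))"
    unfolding set_digit_decomp using s by (simp add: div_add1_eq)
  show "digit d i (set_digit d i x v) = v"
    unfolding digit_def q using v by simp
  show "set_digit d i x v div stride d (Suc i) = x div stride d (Suc i)"
    unfolding stride_Suc[of d i] div_mult2_eq q using v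
    by (simp add: stride_Suc div_mult2_eq)
qed

lemma digit_set_digit_other:
  assumes i: "i < n" and v: "v < d i" and j: "j < n" "j \<noteq> i"
  shows "digit d j (set_digit d i x v) = digit d j x"
proof (cases "j < i")
  case True
  have "stride d i = stride d (Suc j) * (\<Prod>l\<in>{Suc j..<i}. d l)" using stride_split True by simp
  then have m: "y mod stride d i mod stride d (Suc j) = y mod stride d (Suc j)" for y
    by (simp add: mod_mod_cancel)
  have "set_digit d i x v mod stride d (Suc j) = x mod stride d (Suc j)"
    using m[of "set_digit d i x v"] m[of x] set_digit_props(1)[OF i v] by simp
  then have "(set_digit d i x v mod stride d (Suc j)) div stride d j = (x mod stride d (Suc j)) div stride d j"
    by simp
  moreover have "stride d j > 0" using stride_pos[OF d_pos] j by simp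
  ultimately show ?thesis
    unfolding digit_def stride_Suc mod_mult2_eq by simp
next
  case False
  then have "stride d j = stride d (Suc i) * (\<Prod>l\<in>{Suc i..<j}. d l)" using stride_split j by simp
  then show ?thesis
    unfolding digit_def using set_digit_props(2)[OF i v] by (simp add: div_mult2_eq)
qed

lemma set_digit_less:
  assumes i: "i < n" and v: "v < d i" and x: "x < total_dim n d"
  shows "set_digit d i x v < total_dim n d"
proof -
  let ?s = "stride d (Suc i)"
  have s: "0 < ?s" using stride_pos[OF d_pos] i by simp
  have t: "total_dim n d = (\<Prod>l\<in>{Suc i..<n}. d l) * ?s"
    unfolding total_dim_stride using stride_split[of "Suc i" n d] i by simp
  have "x div ?s < (\<Prod>l\<in>{Suc i..<n}. d l)"
    using x s unfolding t by (simp add: less_mult_imp_div_less)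
  then have "set_digit d i x v div ?s < (\<Prod>l\<in>{Suc i..<n}. d l)"
    using set_digit_props(2)[OF i v] by simp
  then show ?thesis unfolding t using s by (simp add: div_less_iff_less_mult)
qed

lemma agree_off_iff:
  assumes i: "i < n" and a: "a < total_dim n d" and b: "b < total_dim n d"
    and ab: "\<forall>j<n. j \<noteq> i \<longrightarrow> digit d j a = digit d j b" "digit d i a = digit d i b"
  shows "a = b"
  using a b ab unfolding total_dim_stride by (intro mixed_radix_unique[of a d n b]) metis+

lemma set_digit_set_digit:
  assumes i: "i < n" and v: "v < d i" "w < d i" and x: "x < total_dim n d"
  shows "set_digit d i (set_digit d i x v) w = set_digit d i x w"
  by (rule agree_off_iff[OF i])
     (use i v x in \<open>simp_all add: set_digit_less digit_set_digit_other set_digit_props(3)\<close>)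

lemma set_digit_digit:
  assumes i: "i < n" and x: "x < total_dim n d"
  shows "set_digit d i x (digit d i x) = x"
proof -
  have "digit d i x < d i" using d_pos i by (simp add: digit_less)
  note k = this
  show ?thesis
    by (rule agree_off_iff[OF i, of _ x])
       (use i x k in \<open>simp_all add: set_digit_less digit_set_digit_other set_digit_props(3)\<close>)
qed

text \<open>The factorisation of the whole system into one subsystem and the rest: an index whose
  digit at \<open>i\<close> is 0 stands for a basis state of the other subsystems, and
  \<open>k\<close> for one of subsystem \<open>i\<close>.\<close>

lemma sum_by_digit:
  fixes f :: "nat \<Rightarrow> 'a :: comm_monoid_add"
  assumes i: "i < n"
  shows "(\<Sum>a<total_dim n d. f a)
    = (\<Sum>z\<in>{a. a < total_dim n d \<and> digit d i a = 0}. \<Sum>k<d i. f (set_digit d i z k))"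
proof -
  have di: "0 < d i" using d_pos i by simp
  let ?Z = "{a. a < total_dim n d \<and> digit d i a = 0}"
  have "(\<Sum>a<total_dim n d. f a) = (\<Sum>(z, k)\<in>?Z \<times> {..<d i}. f (set_digit d i z k))"
  proof (rule sum.reindex_bij_witness[where i = "\<lambda>(z, k). set_digit d i z k" and j = "\<lambda>a. (set_digit d i a 0, digit d i a)"])
    fix a assume "a \<in> {..<total_dim n d}"
    then have a: "a < total_dim n d" by simp
    show "(case (set_digit d i a 0, digit d i a) of (z, k) \<Rightarrow> set_digit d i z k) = a"
      using set_digit_set_digit[OF i di digit_less[of d i a] a] set_digit_digit[OF i a] di by simp
    show "(set_digit d i a 0, digit d i a) \<in> ?Z \<times> {..<d i}"
      using set_digit_less[OF i di a] set_digit_props(3)[OF i di] digit_less[of d i a] di by simp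
    show "(case (set_digit d i a 0, digit d i a) of (z, k) \<Rightarrow> f (set_digit d i z k)) = f a"
      using set_digit_set_digit[OF i di digit_less[of d i a] a] set_digit_digit[OF i a] di by simp
  next
    fix p assume "p \<in> ?Z \<times> {..<d i}"
    then obtain z k where p: "p = (z, k)" "z < total_dim n d" "digit d i z = 0" "k < d i" by auto
    have z: "set_digit d i z 0 = z" using set_digit_digit[OF i p(2)] p(3) by simp
    show "(set_digit d i (case p of (z, k) \<Rightarrow> set_digit d i z k) 0, digit d i (case p of (z, k) \<Rightarrow> set_digit d i z k)) = p"
      using set_digit_set_digit[OF i p(4) di p(2)] set_digit_props(3)[OF i p(4)] p(1) z by simp
    show "(case p of (z, k) \<Rightarrow> set_digit d i z k) \<in> {..<total_dim n d}"
      using set_digit_less[OF i p(4) p(2)] p(1) by simp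
  qed
  then show ?thesis by (simp add: sum.cartesian_product)
qed

text \<open>In the split coordinates a local operator is block diagonal, with one copy of
  \<open>T\<close> for each basis state of the other subsystems.\<close>

lemma embed_local_index:
  assumes i: "i < n" and z: "z < total_dim n d" "digit d i z = 0" and z': "z' < total_dim n d" "digit d i z' = 0"
    and k: "k < d i" "k' < d i"
  shows "embed_local n d i T $$ (set_digit d i z k, set_digit d i z' k') = (if z' = z then T $$ (k, k') else 0)"
proof -
  have "(\<forall>j<n. j \<noteq> i \<longrightarrow> digit d j (set_digit d i z k) = digit d j (set_digit d i z' k')) \<longleftrightarrow> z' = z"
    using agree_off_iff[OF i z(1) z'(1)] i k z z' by (auto simp: digit_set_digit_other)
  then show ?thesis
    using set_digit_less[OF i k(1) z(1)] set_digit_less[OF i k(2) z'(1)] i k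
    by (simp add: embed_local_def set_digit_props(3))
qed

lemma form_embed_local:
  assumes i: "i < n"
  shows "form (total_dim n d) (embed_local n d i T) x y
    = (\<Sum>z\<in>{a. a < total_dim n d \<and> digit d i a = 0}.
         form (d i) T (\<lambda>k. x (set_digit d i z k)) (\<lambda>k. y (set_digit d i z k)))"
proof -
  let ?Z = "{a. a < total_dim n d \<and> digit d i a = 0}"
  have fin: "finite ?Z" by simp
  have "form (total_dim n d) (embed_local n d i T) x y
    = (\<Sum>z\<in>?Z. \<Sum>k<d i. \<Sum>z'\<in>?Z. \<Sum>k'<d i. cnj (x (set_digit d i z k)) *
         embed_local n d i T $$ (set_digit d i z k, set_digit d i z' k') * y (set_digit d i z' k'))"
    unfolding form_def sum_by_digit[OF i] ..
  also have "\<dots> = (\<Sum>z\<in>?Z. \<Sum>k<d i. \<Sum>z'\<in>?Z. if z' = z then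
        (\<Sum>k'<d i. cnj (x (set_digit d i z k)) * T $$ (k, k') * y (set_digit d i z k')) else 0)"
    by (intro sum.cong refl) (auto simp: embed_local_index[OF i])
  also have "\<dots> = (\<Sum>z\<in>?Z. form (d i) T (\<lambda>k. x (set_digit d i z k)) (\<lambda>k. y (set_digit d i z k)))"
    unfolding form_def
  proof (rule sum.cong[OF refl], rule sum.cong[OF refl])
    fix z k assume "z \<in> ?Z"
    then show "(\<Sum>z'\<in>?Z. if z' = z then
        (\<Sum>k'<d i. cnj (x (set_digit d i z k)) * T $$ (k, k') * y (set_digit d i z k')) else 0)
      = (\<Sum>k'<d i. cnj (x (set_digit d i z k)) * T $$ (k, k') * y (set_digit d i z k'))"
      using sum.delta[OF fin] by simp
  qed
  finally show ?thesis .
qed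

text \<open>The digit of \<open>a\<close> at \<open>i\<close> belongs to the fresh state
  \<open>p\<close>, whereas \<open>y\<close> is read with that digit overwritten. The two factors
  separate, and the unit norm of \<open>p\<close> removes the first.\<close>

lemma sum_erased_form:
  fixes p :: "nat \<Rightarrow> complex"
  assumes i: "i < n" and p: "(\<Sum>q<d i. cnj (p q) * p q) = 1"
  shows "(\<Sum>a<total_dim n d. cnj (p (digit d i a)) * p (digit d i a) *
            form (d i) T (\<lambda>k. y (set_digit d i a k)) (\<lambda>k. y (set_digit d i a k)))
    = form (total_dim n d) (embed_local n d i T) y y"
proof -
  let ?Z = "{a. a < total_dim n d \<and> digit d i a = 0}"
  have "(\<Sum>a<total_dim n d. cnj (p (digit d i a)) * p (digit d i a) *
            form (d i) T (\<lambda>k. y (set_digit d i a k)) (\<lambda>k. y (set_digit d i a k)))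
      = (\<Sum>z\<in>?Z. \<Sum>q<d i. cnj (p q) * p q *
            form (d i) T (\<lambda>k. y (set_digit d i z k)) (\<lambda>k. y (set_digit d i z k)))"
    unfolding sum_by_digit[OF i]
  proof (intro sum.cong refl)
    fix z q assume z: "z \<in> ?Z" and q: "q \<in> {..<d i}"
    have "form (d i) T (\<lambda>k. y (set_digit d i (set_digit d i z q) k)) (\<lambda>k. y (set_digit d i (set_digit d i z q) k))
       = form (d i) T (\<lambda>k. y (set_digit d i z k)) (\<lambda>k. y (set_digit d i z k))"
      using z q i by (intro form_cong) (auto simp: set_digit_set_digit)
    then show "cnj (p (digit d i (set_digit d i z q))) * p (digit d i (set_digit d i z q)) *
        form (d i) T (\<lambda>k. y (set_digit d i (set_digit d i z q) k)) (\<lambda>k. y (set_digit d i (set_digit d i z q) k))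
       = cnj (p q) * p q * form (d i) T (\<lambda>k. y (set_digit d i z k)) (\<lambda>k. y (set_digit d i z k))"
      using q i by (simp add: set_digit_props(3))
  qed
  also have "\<dots> = (\<Sum>z\<in>?Z. form (d i) T (\<lambda>k. y (set_digit d i z k)) (\<lambda>k. y (set_digit d i z k)))"
    using p by (simp flip: sum_distrib_right)
  finally show ?thesis by (simp add: form_embed_local[OF i])
qed

lemma form_embed_local_one:
  assumes i: "i < n"
  shows "form (total_dim n d) (embed_local n d i (1\<^sub>m (d i))) x y = ip (total_dim n d) x y"
  unfolding form_embed_local[OF i] form_one by (simp add: ip_def sum_by_digit[OF i])

end

section \<open>Kraus operators of the erasure channel\<close>

text \<open>The vector \<open>N_{i,k} y\<close>, where \<open>N_{i,k} = n^{-1/2} |i\<rangle> \<otimes> |\<phi>_i\<rangle>\<langle>k|\<close> are the Kraus operators of the erasure channel.\<close>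

definition erased :: "nat \<Rightarrow> (nat \<Rightarrow> nat) \<Rightarrow> (nat \<Rightarrow> complex vec) \<Rightarrow> (nat \<Rightarrow> complex) \<Rightarrow> nat \<Rightarrow> nat \<Rightarrow> nat \<Rightarrow> complex" where
  "erased n d \<phi>s y i k b = (if b div total_dim n d = i
     then \<phi>s i $ digit d i (b mod total_dim n d) / of_real (sqrt (real n)) * y (set_digit d i (b mod total_dim n d) k) else 0)"

lemma erased_linear:
  "(\<Sum>q<m. erased n d \<phi>s (\<lambda>a. V $$ (a, q)) i k b * x q) = erased n d \<phi>s (\<lambda>a. \<Sum>q<m. V $$ (a, q) * x q) i k b"
  by (simp add: erased_def sum_distrib_left mult.assoc)

text \<open>The Kraus operators of erasure after encoding are indexed by the lost subsystem
  \<open>i\<close> and a basis state \<open>k\<close> of it, the one used in the partial trace. The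
  index set is a \<open>Sigma\<close> type because the range of \<open>k\<close> depends on
  \<open>i\<close>.\<close>

lemma erasure_encoding_index:
  assumes d_pos: "\<forall>i<n. 0 < d i"
    and V: "V \<in> carrier_mat (total_dim n d) dL" and X: "X \<in> carrier_mat dL dL"
    and b: "b < n * total_dim n d" "b' < n * total_dim n d"
  shows "erasure_channel n d \<phi>s (encoding V X) $$ (b, b') =
    (\<Sum>(i, k)\<in>Sigma {..<n} (\<lambda>i. {..<d i}). \<Sum>q<dL. \<Sum>q'<dL.
        erased n d \<phi>s (\<lambda>a. V $$ (a, q)) i k b * X $$ (q, q') * cnj (erased n d \<phi>s (\<lambda>a. V $$ (a, q')) i k b'))"
    (is "_ = (\<Sum>(i, k)\<in>_. ?t i k)")
proof -
  define D where "D = total_dim n d"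
  define c where "c = b div D"
  have D: "0 < D" using b by (cases "total_dim n d") (auto simp: D_def)
  have cn: "c < n" using b by (simp add: c_def D_def less_mult_imp_div_less)
  have m: "b mod D < D" "b' mod D < D" using D by auto
  \<comment> \<open>The record in \<open>b\<close> singles out one subsystem; all other Kraus
    operators vanish in row \<open>b\<close>.\<close>
  have sum_c: "(\<Sum>(i, k)\<in>Sigma {..<n} (\<lambda>i. {..<d i}). ?t i k) = (\<Sum>k<d c. ?t c k)"
  proof -
    have "(\<Sum>(i, k)\<in>Sigma {..<n} (\<lambda>i. {..<d i}). ?t i k) = (\<Sum>i<n. \<Sum>k<d i. ?t i k)"
      by (subst sum.Sigma) auto
    also have "\<dots> = (\<Sum>i<n. if i = c then \<Sum>k<d c. ?t c k else 0)"
    proof (rule sum.cong[OF refl])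
      fix i
      show "(\<Sum>k<d i. ?t i k) = (if i = c then \<Sum>k<d c. ?t c k else 0)"
      proof (cases "i = c")
        case False
        then have "?t i k = 0" for k
          by (intro sum.neutral ballI) (simp add: erased_def c_def D_def)
        then show ?thesis using False by (simp only: sum.neutral_const if_False)
      qed (simp only: if_True simp_thms)
    qed
    finally show ?thesis using cn by simp
  qed
  show ?thesis
  proof (cases "b' div D = c")
    case True
    have rc: "complex_of_real (sqrt (real n)) * of_real (sqrt (real n)) = of_nat n"
      by (simp flip: of_real_mult)
    have "erasure_channel n d \<phi>s (encoding V X) $$ (b, b')
       = (\<Sum>k<d c. 1 / of_nat n * (\<phi>s c $ digit d c (b mod D) * cnj (\<phi>s c $ digit d c (b' mod D))) *
           encoding V X $$ (set_digit d c (b mod D) k, set_digit d c (b' mod D) k))"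
      using b True m by (simp add: erasure_channel_def replace_sub_def D_def c_def sum_distrib_left mult.assoc)
    also have "\<dots> = (\<Sum>k<d c. ?t c k)"
    proof (rule sum.cong[OF refl])
      fix k assume "k \<in> {..<d c}"
      then have s: "set_digit d c (b mod D) k < D" "set_digit d c (b' mod D) k < D"
        using set_digit_less[OF d_pos cn] m by (auto simp: D_def)
      have "1 / of_nat n * (\<phi>s c $ digit d c (b mod D) * cnj (\<phi>s c $ digit d c (b' mod D))) *
           encoding V X $$ (set_digit d c (b mod D) k, set_digit d c (b' mod D) k)
        = (\<Sum>q<dL. \<Sum>q'<dL. 1 / of_nat n * (\<phi>s c $ digit d c (b mod D) * cnj (\<phi>s c $ digit d c (b' mod D))) *
           (V $$ (set_digit d c (b mod D) k, q) * X $$ (q, q') * cnj (V $$ (set_digit d c (b' mod D) k, q'))))"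
        unfolding encoding_def kraus_term_index[OF V[folded D_def] X s] by (simp add: sum_distrib_left)
      also have "\<dots> = ?t c k"
        using True by (intro sum.cong refl) (simp add: erased_def D_def[symmetric] c_def[symmetric] rc[symmetric])
      finally show "1 / of_nat n * (\<phi>s c $ digit d c (b mod D) * cnj (\<phi>s c $ digit d c (b' mod D))) *
           encoding V X $$ (set_digit d c (b mod D) k, set_digit d c (b' mod D) k) = ?t c k" .
    qed
    finally show ?thesis using sum_c by simp
  next
    case False
    \<comment> \<open>Different records carry no coherence: the operators of subsystem
      \<open>c\<close> vanish in row \<open>b'\<close>, just as the channel output does.\<close>
    then have "(\<Sum>k<d c. ?t c k) = 0" by (simp add: erased_def D_def)
    moreover have "erasure_channel n d \<phi>s (encoding V X) $$ (b, b') = 0"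
      using b False by (simp add: erasure_channel_def D_def c_def)
    ultimately show ?thesis using sum_c by simp
  qed
qed

section \<open>Composition with the recovery and its isometric dilation\<close>

lemma kraus_compose:
  fixes N M :: nat
  shows "(\<Sum>b<N. \<Sum>b'<N. r b * (\<Sum>j\<in>J. \<Sum>q<M. \<Sum>q'<M. W j b q * X q q' * cnj (W j b' q')) * cnj (r' b'))
    = (\<Sum>j\<in>J. \<Sum>q<M. \<Sum>q'<M. (\<Sum>b<N. r b * W j b q) * X q q' * cnj (\<Sum>b<N. r' b * W j b q'))"
proof -
  \<comment> \<open>Packing both output indices into one pair lets a single exchange move them past
    each of the inner sums.\<close>
  let ?B = "{..<N} \<times> {..<N}"
  define t where "t j q q' p = r (fst p) * W j (fst p) q * X q q' * cnj (r' (snd p) * W j (snd p) q')" for j q q' p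
  have "(\<Sum>b<N. \<Sum>b'<N. r b * (\<Sum>j\<in>J. \<Sum>q<M. \<Sum>q'<M. W j b q * X q q' * cnj (W j b' q')) * cnj (r' b'))
      = (\<Sum>p\<in>?B. \<Sum>j\<in>J. \<Sum>q<M. \<Sum>q'<M. t j q q' p)"
    unfolding sum.cartesian_product'
    by (intro sum.cong refl) (auto simp: t_def sum_distrib_left sum_distrib_right mult_ac)
  also have "\<dots> = (\<Sum>j\<in>J. \<Sum>p\<in>?B. \<Sum>q<M. \<Sum>q'<M. t j q q' p)"
    by (rule sum.swap)
  also have "\<dots> = (\<Sum>j\<in>J. \<Sum>q<M. \<Sum>p\<in>?B. \<Sum>q'<M. t j q q' p)"
    by (rule sum.cong[OF refl], rule sum.swap)
  also have "\<dots> = (\<Sum>j\<in>J. \<Sum>q<M. \<Sum>q'<M. \<Sum>p\<in>?B. t j q q' p)"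
    by (rule sum.cong[OF refl], rule sum.cong[OF refl], rule sum.swap)
  also have "\<dots> = (\<Sum>j\<in>J. \<Sum>q<M. \<Sum>q'<M. (\<Sum>b<N. r b * W j b q) * X q q' * cnj (\<Sum>b<N. r' b * W j b q'))"
  proof (rule sum.cong[OF refl], rule sum.cong[OF refl], rule sum.cong[OF refl])
    fix j q q'
    have "(\<Sum>p\<in>?B. t j q q' p) = (\<Sum>b<N. \<Sum>b'<N. (r b * W j b q * X q q') * cnj (r' b' * W j b' q'))"
      unfolding sum.cartesian_product' by (simp add: t_def mult.assoc)
    then show "(\<Sum>p\<in>?B. t j q q' p) = (\<Sum>b<N. r b * W j b q) * X q q' * cnj (\<Sum>b<N. r' b * W j b q')"
      by (simp only: sum_distrib_right[where r = "X q q'"] cnj_sum sum_product)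
  qed
  finally show ?thesis .
qed

text \<open>Orthonormality of the stacked columns collapses the double sum to its diagonal. It
  serves the dilation of the recovery and, with a single Kraus operator, the encoding.\<close>

lemma isometry_ip:
  assumes R: "\<And>b b'. b < N \<Longrightarrow> b' < N \<Longrightarrow> (\<Sum>l<m. \<Sum>s<e. cnj (R l s b) * R l s b') = (if b = b' then 1 else 0)"
  shows "(\<Sum>l<m. \<Sum>s<e. cnj (\<Sum>b<N. R l s b * f b) * (\<Sum>b<N. R l s b * g b)) = ip N f g"
proof -
  let ?B = "{..<N} \<times> {..<N}" and ?L = "{..<m} \<times> {..<e}"
  define t where "t p x = (cnj (R (fst p) (snd p) (fst x)) * R (fst p) (snd p) (snd x)) * (cnj (f (fst x)) * g (snd x))" for p x
  have "(\<Sum>l<m. \<Sum>s<e. cnj (\<Sum>b<N. R l s b * f b) * (\<Sum>b<N. R l s b * g b)) = (\<Sum>p\<in>?L. \<Sum>x\<in>?B. t p x)"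
    unfolding sum.cartesian_product'
    unfolding cnj_sum sum_product by (intro sum.cong refl) (simp add: t_def mult_ac)
  also have "\<dots> = (\<Sum>x\<in>?B. (\<Sum>p\<in>?L. cnj (R (fst p) (snd p) (fst x)) * R (fst p) (snd p) (snd x)) * (cnj (f (fst x)) * g (snd x)))"
    by (subst sum.swap) (simp add: t_def sum_distrib_right)
  also have "\<dots> = (\<Sum>x\<in>?B. if snd x = fst x then cnj (f (fst x)) * g (fst x) else 0)"
  proof (rule sum.cong[OF refl])
    fix x assume "x \<in> ?B"
    then have "(\<Sum>p\<in>?L. cnj (R (fst p) (snd p) (fst x)) * R (fst p) (snd p) (snd x)) = (if fst x = snd x then 1 else 0)"
      using R[of "fst x" "snd x"] by (auto simp: sum.cartesian_product')
    then show "(\<Sum>p\<in>?L. cnj (R (fst p) (snd p) (fst x)) * R (fst p) (snd p) (snd x)) * (cnj (f (fst x)) * g (snd x))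
      = (if snd x = fst x then cnj (f (fst x)) * g (fst x) else 0)" by simp
  qed
  also have "\<dots> = (\<Sum>b<N. \<Sum>b'<N. if b' = b then cnj (f b) * g b else 0)"
    by (simp add: sum.cartesian_product')
  also have "\<dots> = ip N f g" by (simp add: ip_def)
  finally show ?thesis .
qed

text \<open>For a unit replacement state this Gram matrix in \<open>k\<close> and \<open>k'\<close>
  is, up to transposition, the reduced state of subsystem \<open>i\<close> weighted by
  \<open>1/n\<close>. Both vectors live in the block recorded as \<open>i\<close>, and their two
  factors \<open>1 / sqrt n\<close> multiply.\<close>

lemma ip_erased:
  assumes i: "i < n"
  shows "ip (n * total_dim n d) (erased n d \<phi>s y i k) (erased n d \<phi>s y i k')
    = (\<Sum>a<total_dim n d. cnj (\<phi>s i $ digit d i a) * \<phi>s i $ digit d i a *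
         (cnj (y (set_digit d i a k)) * y (set_digit d i a k'))) / of_nat n"
proof -
  let ?D = "total_dim n d"
  have rc: "complex_of_real (sqrt (real n)) * of_real (sqrt (real n)) = of_nat n"
    by (simp flip: of_real_mult)
  have "ip (n * ?D) (erased n d \<phi>s y i k) (erased n d \<phi>s y i k')
     = (\<Sum>c<n. if c = i then (\<Sum>a<?D. cnj (\<phi>s i $ digit d i a) * \<phi>s i $ digit d i a *
         (cnj (y (set_digit d i a k)) * y (set_digit d i a k'))) / of_nat n else 0)"
    unfolding ip_def sum_blocks
  proof (rule sum.cong[OF refl])
    fix c assume "c \<in> {..<n}"
    show "(\<Sum>a<?D. cnj (erased n d \<phi>s y i k (c * ?D + a)) * erased n d \<phi>s y i k' (c * ?D + a))
      = (if c = i then (\<Sum>a<?D. cnj (\<phi>s i $ digit d i a) * \<phi>s i $ digit d i a *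
         (cnj (y (set_digit d i a k)) * y (set_digit d i a k'))) / of_nat n else 0)"
      unfolding sum_divide_distrib
      by (auto simp: erased_def rc[symmetric] mult_ac intro!: sum.cong sum.neutral)
  qed
  then show ?thesis using i by simp
qed

text \<open>Summing over \<open>l\<close> and \<open>s\<close> traces out the recovered system and the recovery's ancilla; what remains is the
  environment of the erasure channel, which holds \<open>A_i\<close> with probability \<open>1/n\<close>.\<close>

lemma environment_form:
  assumes d_pos: "\<forall>i<n. 0 < d i" and i: "i < n" and phi: "\<phi>s i \<in> unit_vec_set (d i)"
    and R: "\<And>b b'. b < n * total_dim n d \<Longrightarrow> b' < n * total_dim n d \<Longrightarrow>
       (\<Sum>l<m. \<Sum>s<e. cnj (R l s b) * R l s b') = (if b = b' then 1 else 0)"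
    and \<Psi>: "\<And>l k s. \<Psi> l s k = (\<Sum>b<n * total_dim n d. R l s b * erased n d \<phi>s y i k b)"
  shows "(\<Sum>l<m. \<Sum>s<e. form (d i) G (\<Psi> l s) (\<Psi> l s))
    = form (total_dim n d) (embed_local n d i G) y y / of_nat n"
proof -
  let ?D = "total_dim n d"
  let ?L = "{..<m} \<times> {..<e}"
  have p: "(\<Sum>q<d i. cnj (\<phi>s i $ q) * \<phi>s i $ q) = 1"
  proof -
    have v: "\<phi>s i \<in> carrier_vec (d i)" "\<phi>s i \<bullet>c \<phi>s i = 1" using phi by (auto simp: unit_vec_set_def)
    then show ?thesis by (simp add: scalar_prod_def atLeast0LessThan mult.commute)
  qed
  \<comment> \<open>The dilated recovery is an isometry, so it cannot alter the Gram matrix: what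
    the environment sees does not depend on the recovery.\<close>
  have gram: "(\<Sum>x\<in>?L. cnj (\<Psi> (fst x) (snd x) k) * \<Psi> (fst x) (snd x) k')
      = ip (n * ?D) (erased n d \<phi>s y i k) (erased n d \<phi>s y i k')" for k k'
    using isometry_ip[where f = "erased n d \<phi>s y i k" and g = "erased n d \<phi>s y i k'", OF R]
    by (simp add: \<Psi> sum.cartesian_product')
  have "(\<Sum>l<m. \<Sum>s<e. form (d i) G (\<Psi> l s) (\<Psi> l s))
      = (\<Sum>x\<in>?L. \<Sum>k<d i. \<Sum>k'<d i. G $$ (k, k') * (cnj (\<Psi> (fst x) (snd x) k) * \<Psi> (fst x) (snd x) k'))"
    by (simp add: form_def sum.cartesian_product' mult_ac)
  also have "\<dots> = (\<Sum>k<d i. \<Sum>x\<in>?L. \<Sum>k'<d i. G $$ (k, k') * (cnj (\<Psi> (fst x) (snd x) k) * \<Psi> (fst x) (snd x) k'))"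
    by (rule sum.swap)
  also have "\<dots> = (\<Sum>k<d i. \<Sum>k'<d i. \<Sum>x\<in>?L. G $$ (k, k') * (cnj (\<Psi> (fst x) (snd x) k) * \<Psi> (fst x) (snd x) k'))"
    by (rule sum.cong[OF refl], rule sum.swap)
  also have "\<dots> = (\<Sum>k<d i. \<Sum>k'<d i. G $$ (k, k') * ip (n * ?D) (erased n d \<phi>s y i k) (erased n d \<phi>s y i k'))"
    by (simp add: gram flip: sum_distrib_left)
  also have "\<dots> = (\<Sum>k<d i. \<Sum>k'<d i. \<Sum>a<?D. cnj (\<phi>s i $ digit d i a) * \<phi>s i $ digit d i a *
         (cnj (y (set_digit d i a k)) * G $$ (k, k') * y (set_digit d i a k')) / of_nat n)"
    unfolding ip_erased[OF i] sum_divide_distrib sum_distrib_left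
    by (simp add: mult_ac)
  also have "\<dots> = (\<Sum>k<d i. \<Sum>a<?D. \<Sum>k'<d i. cnj (\<phi>s i $ digit d i a) * \<phi>s i $ digit d i a *
         (cnj (y (set_digit d i a k)) * G $$ (k, k') * y (set_digit d i a k')) / of_nat n)"
    by (rule sum.cong[OF refl], rule sum.swap)
  also have "\<dots> = (\<Sum>a<?D. \<Sum>k<d i. \<Sum>k'<d i. cnj (\<phi>s i $ digit d i a) * \<phi>s i $ digit d i a *
         (cnj (y (set_digit d i a k)) * G $$ (k, k') * y (set_digit d i a k')) / of_nat n)"
    by (rule sum.swap)
  also have "\<dots> = (\<Sum>a<?D. cnj (\<phi>s i $ digit d i a) * \<phi>s i $ digit d i a *
         form (d i) G (\<lambda>k. y (set_digit d i a k)) (\<lambda>k. y (set_digit d i a k))) / of_nat n"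
    unfolding form_def sum_divide_distrib sum_distrib_left by simp
  also have "\<dots> = form ?D (embed_local n d i G) y y / of_nat n"
    using sum_erased_form[OF d_pos i, of "\<lambda>q. \<phi>s i $ q" G y] p by simp
  finally show ?thesis .
qed

section \<open>Distinguishability through the environment\<close>

text \<open>The difference of the forms at \<open>A\<close> and \<open>B\<close> is the real part of
  the sesquilinear form at \<open>X = A - B\<close> and \<open>Y = A + B\<close>. Polarisation with
  \<open>X\<close> scaled by \<open>sqrt t\<close> and \<open>Y\<close> by \<open>1 / sqrt t\<close>
  writes this as a difference of forms at \<open>P\<close> and \<open>M\<close>, and the
  parallelogram law adds up their norms. No square roots of norms appear, so the bound can be
  summed.\<close>

lemma Re_form_diff_le:
  assumes S: "S \<in> carrier_mat n n" "hermitian_mat S"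
    and bound: "\<And>x. \<bar>Re (form n S x x)\<bar> \<le> \<tau> * Re (ip n x x)" and t: "t > 0"
  shows "Re (form n S A A) - Re (form n S B B)
    \<le> \<tau> / 2 * (t * Re (ip n (\<lambda>k. A k - B k) (\<lambda>k. A k - B k)) + Re (ip n (\<lambda>k. A k + B k) (\<lambda>k. A k + B k)) / t)"
proof -
  define X where "X k = A k - B k" for k
  define Y where "Y k = A k + B k" for k
  obtain r r' :: real where r: "r * r = t" "r * r' = 1" "r' * r' = 1 / t"
    using t that[of "sqrt t" "1 / sqrt t"] by simp
  define u where "u = complex_of_real r"
  define u' where "u' = complex_of_real r'"
  have u: "u * u = of_real t" "u * u' = 1" "u' * u' = of_real (1 / t)" "cnj u = u" "cnj u' = u'"
    using r by (simp_all add: u_def u'_def flip: of_real_mult)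
  define P where "P k = u * X k + u' * Y k" for k
  define M where "M k = u * X k - u' * Y k" for k
  have "form n S X Y + form n S Y X = 2 * form n S A A - 2 * form n S B B"
    unfolding form_def sum_distrib_left sum_subtractf[symmetric] sum.distrib[symmetric] X_def Y_def
    by (intro sum.cong refl) (simp add: algebra_simps)
  moreover have "Re (form n S Y X) = Re (form n S X Y)"
    using form_hermitian[OF S, of X Y] by (metis cnj.simps(1))
  ultimately have AB: "Re (form n S A A) - Re (form n S B B) = Re (form n S X Y)"
    by (auto simp: complex_eq_iff)
  have "form n S P P - form n S M M = 2 * (u * u') * form n S X Y + 2 * (u * u') * form n S Y X"
    unfolding form_def sum_distrib_left sum_subtractf[symmetric] sum.distrib[symmetric] P_def M_def
    by (intro sum.cong refl) (simp add: u(4,5) algebra_simps)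
  then have "4 * Re (form n S X Y) = Re (form n S P P) - Re (form n S M M)"
    using \<open>Re (form n S Y X) = Re (form n S X Y)\<close> by (auto simp: u complex_eq_iff)
  also have "\<dots> \<le> \<tau> * (Re (ip n P P) + Re (ip n M M))"
    using bound[of P] bound[of M] by (simp add: distrib_left)
  also have "ip n P P + ip n M M = 2 * ((u * u) * ip n X X + (u' * u') * ip n Y Y)"
    unfolding ip_def sum_distrib_left sum.distrib[symmetric] P_def M_def
    by (intro sum.cong refl) (simp add: u(4,5) algebra_simps)
  then have "Re (ip n P P) + Re (ip n M M) = 2 * (t * Re (ip n X X) + Re (ip n Y Y) / t)"
    unfolding u by (auto simp: complex_eq_iff)
  finally have fin: "4 * Re (form n S X Y) \<le> \<tau> * (2 * (t * Re (ip n X X) + Re (ip n Y Y) / t))" .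
  have XY: "(\<lambda>k. A k - B k) = X" "(\<lambda>k. A k + B k) = Y" by (simp_all add: X_def Y_def fun_eq_iff)
  have "\<tau> * (2 * z) = 4 * (\<tau> / 2 * z)" for z :: real by simp
  from fin[unfolded this] show ?thesis unfolding AB XY by linarith
qed

text \<open>Expanding the squared distance to a product vector: the cross term contracts
  \<open>\<Psi>\<close> with \<open>x\<close> first, and those contractions are what the averaged
  amplitude is made of.\<close>

lemma sum_cmod_diff_rank_one:
  "(\<Sum>s<e. \<Sum>k<m. (cmod (\<Psi> s k - x s * w k))\<^sup>2)
    = (\<Sum>s<e. \<Sum>k<m. (cmod (\<Psi> s k))\<^sup>2) + Re (ip e x x) * (\<Sum>k<m. (cmod (w k))\<^sup>2)
      - 2 * (\<Sum>k<m. Re (cnj (w k) * (\<Sum>s<e. cnj (x s) * \<Psi> s k)))"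
proof -
  have pt: "(cmod (\<Psi> s k - x s * w k))\<^sup>2
    = (cmod (\<Psi> s k))\<^sup>2 + (cmod (x s))\<^sup>2 * (cmod (w k))\<^sup>2 - 2 * Re (cnj (w k) * (cnj (x s) * \<Psi> s k))" for s k
    unfolding cmod_power2 by (simp add: power2_eq_square algebra_simps)
  have "(\<Sum>s<e. \<Sum>k<m. (cmod (\<Psi> s k - x s * w k))\<^sup>2)
    = (\<Sum>s<e. \<Sum>k<m. (cmod (\<Psi> s k))\<^sup>2) + (\<Sum>s<e. \<Sum>k<m. (cmod (x s))\<^sup>2 * (cmod (w k))\<^sup>2)
      - 2 * (\<Sum>s<e. \<Sum>k<m. Re (cnj (w k) * (cnj (x s) * \<Psi> s k)))"
    unfolding pt sum.distrib sum_subtractf sum_distrib_left ..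
  also have "(\<Sum>s<e. \<Sum>k<m. (cmod (x s))\<^sup>2 * (cmod (w k))\<^sup>2) = Re (ip e x x) * (\<Sum>k<m. (cmod (w k))\<^sup>2)"
    by (simp add: ip_self sum_product)
  also have "(\<Sum>s<e. \<Sum>k<m. Re (cnj (w k) * (cnj (x s) * \<Psi> s k))) = (\<Sum>k<m. Re (cnj (w k) * (\<Sum>s<e. cnj (x s) * \<Psi> s k)))"
    by (subst sum.swap) (simp only: sum_distrib_left Re_sum)
  finally show ?thesis .
qed

lemma form_scale: "form n S (\<lambda>k. c * x k) (\<lambda>k. c * x k) = of_real ((cmod c)\<^sup>2) * form n S x x"
  unfolding form_def sum_distrib_left complex_norm_square by (intro sum.cong refl) (simp add: mult_ac)

text \<open>\<open>\<Psi>\<^sub>1, \<Psi>\<^sub>2\<close> are the joint states of output and environment for the inputs \<open>x\<^sub>1, x\<^sub>2\<close>, and \<open>h\<close> the squared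
  entanglement fidelity. Comparing \<open>\<Psi>\<^sub>1, \<Psi>\<^sub>2\<close> with the product vectors \<open>x\<^sub>1 \<otimes> w, x\<^sub>2 \<otimes> w\<close>, which an environment
  observable cannot distinguish, bounds the difference of the environment expectations.\<close>

lemma environment_distinguishability:
  fixes J :: "'j set" and m :: "'j \<Rightarrow> nat"
  assumes J: "finite J"
    and S: "\<And>j. j \<in> J \<Longrightarrow> S j \<in> carrier_mat (m j) (m j)" "\<And>j. j \<in> J \<Longrightarrow> hermitian_mat (S j)"
    and bound: "\<And>j x. j \<in> J \<Longrightarrow> \<bar>Re (form (m j) (S j) x x)\<bar> \<le> \<tau> * Re (ip (m j) x x)"
    and \<tau>: "\<tau> \<ge> 0"
    and x: "ip e x1 x1 = 1" "ip e x2 x2 = 1"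
    and n1: "(\<Sum>j\<in>J. \<Sum>s<e. \<Sum>k<m j. (cmod (\<Psi>1 j s k))\<^sup>2) = 1"
    and n2: "(\<Sum>j\<in>J. \<Sum>s<e. \<Sum>k<m j. (cmod (\<Psi>2 j s k))\<^sup>2) = 1"
    and w: "\<And>j k. w j k = ((\<Sum>s<e. cnj (x1 s) * \<Psi>1 j s k) + (\<Sum>s<e. cnj (x2 s) * \<Psi>2 j s k)) / 2"
    and h: "h = (\<Sum>j\<in>J. \<Sum>k<m j. (cmod (w j k))\<^sup>2)"
  shows "h \<le> 1"
    and "t > 0 \<Longrightarrow> (\<Sum>j\<in>J. \<Sum>s<e. Re (form (m j) (S j) (\<Psi>1 j s) (\<Psi>1 j s))) -
      (\<Sum>j\<in>J. \<Sum>s<e. Re (form (m j) (S j) (\<Psi>2 j s) (\<Psi>2 j s))) \<le> \<tau> * (t * (1 - h) + 4 / t)"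
proof -
  define D where "D \<Psi> x = (\<Sum>j\<in>J. \<Sum>s<e. \<Sum>k<m j. (cmod (\<Psi> j s k - x s * w j k))\<^sup>2)"
    for \<Psi> :: "'j \<Rightarrow> nat \<Rightarrow> nat \<Rightarrow> complex" and x :: "nat \<Rightarrow> complex"
  define U where "U \<Psi> x = (\<Sum>j\<in>J. \<Sum>s<e. \<Sum>k<m j. (cmod (\<Psi> j s k + x s * w j k))\<^sup>2)"
    for \<Psi> :: "'j \<Rightarrow> nat \<Rightarrow> nat \<Rightarrow> complex" and x :: "nat \<Rightarrow> complex"
  define c where "c \<Psi> x = (\<Sum>j\<in>J. \<Sum>k<m j. Re (cnj (w j k) * (\<Sum>s<e. cnj (x s) * \<Psi> j s k)))"
    for \<Psi> :: "'j \<Rightarrow> nat \<Rightarrow> nat \<Rightarrow> complex" and x :: "nat \<Rightarrow> complex"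
  define E where "E \<Psi> = (\<Sum>j\<in>J. \<Sum>s<e. Re (form (m j) (S j) (\<Psi> j s) (\<Psi> j s)))"
    for \<Psi> :: "'j \<Rightarrow> nat \<Rightarrow> nat \<Rightarrow> complex"
  define N where "N \<Psi> = (\<Sum>j\<in>J. \<Sum>s<e. \<Sum>k<m j. (cmod (\<Psi> j s k))\<^sup>2)"
    for \<Psi> :: "'j \<Rightarrow> nat \<Rightarrow> nat \<Rightarrow> complex"
  define F where "F = (\<Sum>j\<in>J. Re (form (m j) (S j) (w j) (w j)))"
  have xs: "(\<Sum>s<e. (cmod (x s))\<^sup>2) = 1" if "ip e x x = 1" for x
    using that by (metis ip_self of_real_eq_1_iff)
  have D_eq: "D \<Psi> x = N \<Psi> + h - 2 * c \<Psi> x" if "ip e x x = 1" for \<Psi> x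
    unfolding D_def sum_cmod_diff_rank_one N_def h c_def
    using that by (simp add: sum.distrib sum_subtractf sum_distrib_left)
  \<comment> \<open>Since \<open>w\<close> is the mean of the two environment amplitudes, its inner
    products with them add up to twice its squared norm.\<close>
  have "c \<Psi>1 x1 + c \<Psi>2 x2 = (\<Sum>j\<in>J. \<Sum>k<m j. Re (cnj (w j k) * (2 * w j k)))"
    unfolding c_def sum.distrib[symmetric]
  proof (intro sum.cong refl)
    fix j k
    have "(\<Sum>s<e. cnj (x1 s) * \<Psi>1 j s k) + (\<Sum>s<e. cnj (x2 s) * \<Psi>2 j s k) = 2 * w j k"
      unfolding w by simp
    then show "Re (cnj (w j k) * (\<Sum>s<e. cnj (x1 s) * \<Psi>1 j s k)) + Re (cnj (w j k) * (\<Sum>s<e. cnj (x2 s) * \<Psi>2 j s k))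
        = Re (cnj (w j k) * (2 * w j k))"
      by (metis distrib_left plus_complex.sel(1))
  qed
  also have "\<dots> = 2 * h"
    unfolding h sum_distrib_left cmod_power2 by (intro sum.cong refl) (simp add: power2_eq_square)
  finally have cc: "c \<Psi>1 x1 + c \<Psi>2 x2 = 2 * h" .
  have DD: "D \<Psi>1 x1 + D \<Psi>2 x2 = 2 * (1 - h)"
    using D_eq[OF x(1), of \<Psi>1] D_eq[OF x(2), of \<Psi>2] cc n1 n2 by (simp add: N_def)
  have "D \<Psi> x \<ge> 0" for \<Psi> x unfolding D_def by (intro sum_nonneg) simp
  from this[of \<Psi>1 x1] this[of \<Psi>2 x2] DD show h1: "h \<le> 1" by simp
  have U_le: "U \<Psi> x \<le> 2 * N \<Psi> + 2 * h" if "ip e x x = 1" for \<Psi> x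
  proof -
    have "(cmod (a + b))\<^sup>2 \<le> 2 * (cmod a)\<^sup>2 + 2 * (cmod b)\<^sup>2" for a b
    proof -
      have "(cmod (a + b))\<^sup>2 + (cmod (a - b))\<^sup>2 = 2 * (cmod a)\<^sup>2 + 2 * (cmod b)\<^sup>2"
        unfolding cmod_power2 by (simp add: power2_eq_square algebra_simps)
      then show ?thesis by (smt (verit) zero_le_power2)
    qed
    then have "U \<Psi> x \<le> (\<Sum>j\<in>J. \<Sum>s<e. \<Sum>k<m j. 2 * (cmod (\<Psi> j s k))\<^sup>2 + 2 * (cmod (x s * w j k))\<^sup>2)"
      unfolding U_def by (intro sum_mono)
    also have "\<dots> = 2 * N \<Psi> + 2 * (\<Sum>j\<in>J. (\<Sum>s<e. (cmod (x s))\<^sup>2) * (\<Sum>k<m j. (cmod (w j k))\<^sup>2))"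
    proof -
      have "(\<Sum>s<e. \<Sum>k<m j. 2 * (cmod (x s * w j k))\<^sup>2) = 2 * ((\<Sum>s<e. (cmod (x s))\<^sup>2) * (\<Sum>k<m j. (cmod (w j k))\<^sup>2))" for j
        unfolding sum_product norm_mult power_mult_distrib by (simp only: sum_distrib_left)
      then show ?thesis
        by (simp only: N_def sum.distrib) (simp only: sum_distrib_left)
    qed
    also have "\<dots> = 2 * N \<Psi> + 2 * h" using xs[OF that] by (simp add: h)
    finally show ?thesis .
  qed
  show "E \<Psi>1 - E \<Psi>2 \<le> \<tau> * (t * (1 - h) + 4 / t)" if t: "t > 0"
  proof -
    \<comment> \<open>\<open>F\<close> is common to both inputs: for a unit \<open>x\<close>, the
      expectation of \<open>S\<close> in \<open>x \<otimes> w\<close> is that in \<open>w\<close>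
      alone. The absolute value is needed because the first input uses one sign and the second the
      other.\<close>
    have step: "\<bar>E \<Psi> - F\<bar> \<le> \<tau> / 2 * (t * D \<Psi> x + U \<Psi> x / t)" if x: "ip e x x = 1" for \<Psi> x
    proof -
      have F: "F = (\<Sum>j\<in>J. \<Sum>s<e. Re (form (m j) (S j) (\<lambda>k. x s * w j k) (\<lambda>k. x s * w j k)))"
        unfolding F_def form_scale using xs[OF x] by (simp flip: sum_distrib_right)
      have rhs: "\<tau> / 2 * (t * D \<Psi> x + U \<Psi> x / t) = (\<Sum>j\<in>J. \<Sum>s<e. \<tau> / 2 *
          (t * Re (ip (m j) (\<lambda>k. \<Psi> j s k - x s * w j k) (\<lambda>k. \<Psi> j s k - x s * w j k))
           + Re (ip (m j) (\<lambda>k. \<Psi> j s k + x s * w j k) (\<lambda>k. \<Psi> j s k + x s * w j k)) / t))"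
        by (simp add: D_def U_def ip_self sum_distrib_left sum.distrib distrib_left sum_divide_distrib)
      have a: "Re (form (m j) (S j) (\<Psi> j s) (\<Psi> j s)) - Re (form (m j) (S j) (\<lambda>k. x s * w j k) (\<lambda>k. x s * w j k))
          \<le> \<tau> / 2 * (t * Re (ip (m j) (\<lambda>k. \<Psi> j s k - x s * w j k) (\<lambda>k. \<Psi> j s k - x s * w j k))
           + Re (ip (m j) (\<lambda>k. \<Psi> j s k + x s * w j k) (\<lambda>k. \<Psi> j s k + x s * w j k)) / t)" if "j \<in> J" for j s
        by (rule Re_form_diff_le[OF S(1)[OF that] S(2)[OF that] bound[OF that] t])
      have b: "Re (form (m j) (S j) (\<lambda>k. x s * w j k) (\<lambda>k. x s * w j k)) - Re (form (m j) (S j) (\<Psi> j s) (\<Psi> j s))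
          \<le> \<tau> / 2 * (t * Re (ip (m j) (\<lambda>k. \<Psi> j s k - x s * w j k) (\<lambda>k. \<Psi> j s k - x s * w j k))
           + Re (ip (m j) (\<lambda>k. \<Psi> j s k + x s * w j k) (\<lambda>k. \<Psi> j s k + x s * w j k)) / t)" if "j \<in> J" for j s
      proof -
        have "Re (ip (m j) (\<lambda>k. x s * w j k - \<Psi> j s k) (\<lambda>k. x s * w j k - \<Psi> j s k))
            = Re (ip (m j) (\<lambda>k. \<Psi> j s k - x s * w j k) (\<lambda>k. \<Psi> j s k - x s * w j k))"
          by (simp add: ip_self norm_minus_commute)
        then show ?thesis
          using Re_form_diff_le[OF S(1)[OF that] S(2)[OF that] bound[OF that] t, of "\<lambda>k. x s * w j k" "\<Psi> j s"]
          by (simp add: add.commute)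
      qed
      have "E \<Psi> - F \<le> \<tau> / 2 * (t * D \<Psi> x + U \<Psi> x / t)"
        unfolding rhs E_def F sum_subtractf[symmetric] using a by (intro sum_mono)
      moreover have "F - E \<Psi> \<le> \<tau> / 2 * (t * D \<Psi> x + U \<Psi> x / t)"
        unfolding rhs E_def F sum_subtractf[symmetric] using b by (intro sum_mono)
      ultimately show ?thesis by linarith
    qed
    have "E \<Psi>1 - E \<Psi>2 \<le> \<tau> / 2 * (t * D \<Psi>1 x1 + U \<Psi>1 x1 / t) + \<tau> / 2 * (t * D \<Psi>2 x2 + U \<Psi>2 x2 / t)"
      using step[OF x(1), of \<Psi>1] step[OF x(2), of \<Psi>2] by linarith
    also have "\<dots> = \<tau> / 2 * (t * (D \<Psi>1 x1 + D \<Psi>2 x2) + (U \<Psi>1 x1 + U \<Psi>2 x2) / t)"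
      by (simp add: algebra_simps add_divide_distrib)
    \<comment> \<open>By \<open>U_le\<close> each \<open>U\<close> is at most
      \<open>2 + 2 * h\<close>, hence at most 4; the two together give the 8.\<close>
    also have "\<dots> \<le> \<tau> / 2 * (t * (2 * (1 - h)) + 8 / t)"
      using U_le[OF x(1), of \<Psi>1] U_le[OF x(2), of \<Psi>2] n1 n2 h1 t \<tau>
      unfolding DD by (intro mult_left_mono add_left_mono divide_right_mono) (auto simp: N_def)
    also have "\<dots> = \<tau> * (t * (1 - h) + 4 / t)" by (simp add: algebra_simps)
    finally show ?thesis .
  qed
qed

section \<open>The covariant code\<close>

lemma form_msum:
  assumes "\<And>i. i < n \<Longrightarrow> f i \<in> carrier_mat D D"
  shows "form D (msum D (map f [0..<n])) x y = (\<Sum>i<n. form D (f i) x y)"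
proof -
  have "set (map f [0..<n]) \<subseteq> carrier_mat D D" using assms by auto
  note e = msum_index[OF this]
  have "form D (msum D (map f [0..<n])) x y = (\<Sum>a<D. \<Sum>b<D. \<Sum>i<n. cnj (x a) * f i $$ (a, b) * y b)"
    unfolding form_def by (intro sum.cong refl) (simp add: e sum_distrib_left sum_distrib_right)
  also have "\<dots> = (\<Sum>a<D. \<Sum>i<n. \<Sum>b<D. cnj (x a) * f i $$ (a, b) * y b)"
    by (rule sum.cong[OF refl], rule sum.swap)
  also have "\<dots> = (\<Sum>i<n. form D (f i) x y)"
    unfolding form_def by (rule sum.swap)
  finally show ?thesis .
qed

lemma form_conjugate:
  assumes V: "V \<in> carrier_mat D m" and T: "T \<in> carrier_mat D D"
  shows "form m (mat_adjoint V * T * V) x x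
    = form D T (\<lambda>a. \<Sum>q<m. V $$ (a, q) * x q) (\<lambda>a. \<Sum>q<m. V $$ (a, q) * x q)"
proof -
  have Va: "mat_adjoint V \<in> carrier_mat m D" by (rule mat_adjoint_carrier[OF V])
  have VT: "mat_adjoint V * T \<in> carrier_mat m D" using Va T by simp
  define t where "t q q' a b = cnj (V $$ (a, q) * x q) * T $$ (a, b) * (V $$ (b, q') * x q')" for q q' a b
  have "form m (mat_adjoint V * T * V) x x = (\<Sum>q<m. \<Sum>q'<m. \<Sum>b<D. \<Sum>a<D. t q q' a b)"
    unfolding form_def
  proof (intro sum.cong refl)
    fix q q' assume q: "q \<in> {..<m}" "q' \<in> {..<m}"
    then have q: "q < m" "q' < m" by auto
    have "(mat_adjoint V * T * V) $$ (q, q') = (\<Sum>b<D. (\<Sum>a<D. cnj (V $$ (a, q)) * T $$ (a, b)) * V $$ (b, q'))"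
      unfolding mult_mat_index[OF VT V q]
    proof (rule sum.cong[OF refl])
      fix b assume "b \<in> {..<D}"
      then have b: "b < D" by simp
      show "(mat_adjoint V * T) $$ (q, b) * V $$ (b, q') = (\<Sum>a<D. cnj (V $$ (a, q)) * T $$ (a, b)) * V $$ (b, q')"
        unfolding mult_mat_index[OF Va T q(1) b] using V q by simp
    qed
    then show "cnj (x q) * (mat_adjoint V * T * V) $$ (q, q') * x q' = (\<Sum>b<D. \<Sum>a<D. t q q' a b)"
      by (simp add: t_def sum_distrib_left sum_distrib_right mult_ac)
  qed
  also have "\<dots> = (\<Sum>p\<in>{..<m} \<times> {..<m}. \<Sum>c\<in>{..<D} \<times> {..<D}. t (fst p) (snd p) (snd c) (fst c))"
    unfolding sum.cartesian_product' by simp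
  also have "\<dots> = (\<Sum>b<D. \<Sum>a<D. \<Sum>q<m. \<Sum>q'<m. t q q' a b)"
    by (subst sum.swap) (simp add: sum.cartesian_product')
  also have "\<dots> = (\<Sum>a<D. \<Sum>b<D. \<Sum>q<m. \<Sum>q'<m. t q q' a b)"
    by (rule sum.swap)
  also have "\<dots> = form D T (\<lambda>a. \<Sum>q<m. V $$ (a, q) * x q) (\<lambda>a. \<Sum>q<m. V $$ (a, q) * x q)"
    unfolding form_def
  proof (rule sum.cong[OF refl], rule sum.cong[OF refl])
    fix a b
    show "(\<Sum>q<m. \<Sum>q'<m. t q q' a b) = cnj (\<Sum>q<m. V $$ (a, q) * x q) * T $$ (a, b) * (\<Sum>q<m. V $$ (b, q) * x q)"
      unfolding t_def cnj_sum sum_distrib_right[where r = "T $$ (a, b)"] sum_product ..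
  qed
  finally show ?thesis .
qed

lemma ip_isometry:
  assumes V: "V \<in> carrier_mat D m" and iso: "mat_adjoint V * V = 1\<^sub>m m"
  shows "ip D (\<lambda>a. \<Sum>q<m. V $$ (a, q) * x q) (\<lambda>a. \<Sum>q<m. V $$ (a, q) * x q) = ip m x x"
proof -
  have "(\<Sum>l<1::nat. \<Sum>s<D. cnj (V $$ (s, b)) * V $$ (s, b')) = (if b = b' then 1 else 0)" if "b < m" "b' < m" for b b'
    using gram_index[OF V that] iso that by simp
  from isometry_ip[where R = "\<lambda>_ s b. V $$ (s, b)" and f = x and g = x, OF this]
  show ?thesis by (simp add: ip_def)
qed

text \<open>The channel that discards its input and prepares basis state 0. It keeps the supremum
  over recoveries from ranging over an empty set.\<close>

lemma is_channel_exists: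
  assumes "0 < dL"
  shows "\<exists>R. is_channel dB dL R"
proof -
  define K where "K b = mat dL dB (\<lambda>(s, b'). if s = 0 \<and> b' = b then 1 else 0 :: complex)" for b
  define Ks where "Ks = map K [0..<dB]"
  have Kc: "K b \<in> carrier_mat dL dB" for b by (simp add: K_def)
  have sub: "set (map (\<lambda>K. mat_adjoint K * K) Ks) \<subseteq> carrier_mat dB dB"
    by (auto simp: Ks_def intro!: gram_carrier[OF Kc])
  have "msum dB (map (\<lambda>K. mat_adjoint K * K) Ks) = 1\<^sub>m dB"
  proof (rule eq_matI)
    fix i j assume "i < dim_row (1\<^sub>m dB :: complex mat)" "j < dim_col (1\<^sub>m dB :: complex mat)"
    then have ij: "i < dB" "j < dB" by auto
    have "msum dB (map (\<lambda>K. mat_adjoint K * K) Ks) $$ (i, j) = (\<Sum>b<dB. (mat_adjoint (K b) * K b) $$ (i, j))"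
      unfolding msum_index[OF sub ij] by (rule sum.cong) (auto simp: Ks_def simp del: index_mult_mat(1))
    also have "\<dots> = (\<Sum>b<dB. if b = i then (if i = j then 1 else 0) else 0)"
    proof (rule sum.cong[OF refl])
      fix b
      have "(mat_adjoint (K b) * K b) $$ (i, j) = (\<Sum>l<dL. if l = 0 then (if b = i \<and> i = j then 1 else 0) else 0)"
        unfolding gram_index[OF Kc ij] by (rule sum.cong[OF refl]) (use ij in \<open>auto simp: K_def\<close>)
      then show "(mat_adjoint (K b) * K b) $$ (i, j) = (if b = i then (if i = j then 1 else 0) else 0)"
        using assms by simp
    qed
    also have "\<dots> = (1\<^sub>m dB) $$ (i, j)" using ij by simp
    finally show "msum dB (map (\<lambda>K. mat_adjoint K * K) Ks) $$ (i, j) = (1\<^sub>m dB) $$ (i, j)" .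
  qed (use msum_carrier[OF sub] in auto)
  then have "is_channel dB dL (\<lambda>X. msum dL (map (\<lambda>K. K * X * mat_adjoint K) Ks))"
    unfolding is_channel_def using Kc by (intro exI[of _ Ks]) (auto simp: Ks_def)
  then show ?thesis by blast
qed

lemma embed_local_carrier: "embed_local n d i T \<in> carrier_mat (total_dim n d) (total_dim n d)"
  by (simp add: embed_local_def)

text \<open>The whole argument for one fixed recovery. Environment indices are \<open>l\<close>
  (Kraus operator of the recovery), \<open>i\<close> (lost subsystem) and \<open>k\<close> (basis
  state of the lost subsystem); \<open>s\<close> labels the recovered system. The parameter
  \<open>t\<close> stays free so that it can be tuned to the target bound.\<close>

lemma covariant_code_fidelity:
  fixes n dL :: nat and d :: "nat \<Rightarrow> nat" and V TL TA :: "complex mat"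
    and T :: "nat \<Rightarrow> complex mat" and \<phi>s :: "nat \<Rightarrow> complex vec"
  assumes n_pos: "0 < n" and d_pos: "\<forall>i<n. 0 < d i"
    and V: "V \<in> carrier_mat (total_dim n d) dL" and V_iso: "mat_adjoint V * V = 1\<^sub>m dL"
    and T: "\<forall>i<n. T i \<in> carrier_mat (d i) (d i)" "\<forall>i<n. hermitian_mat (T i)"
    and TA_def: "TA = msum (total_dim n d) (map (\<lambda>i. embed_local n d i (T i)) [0..<n])"
    and covariant: "mat_adjoint V * TA * V = TL"
    and phi_unit: "\<forall>i<n. \<phi>s i \<in> unit_vec_set (d i)"
    and x: "ip dL x1 x1 = 1" "ip dL x2 x2 = 1"
    and R: "is_channel (n * total_dim n d) dL R"
    and v: "v \<in> carrier_vec (2 * dL)" "ip (2 * dL) (vec_index v) (vec_index v) = 1"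
      "\<And>s. s < dL \<Longrightarrow> v $ s = x1 s / of_real (sqrt 2)" "\<And>s. s < dL \<Longrightarrow> v $ (dL + s) = x2 s / of_real (sqrt 2)"
  obtains h where "ent_fidelity dL 2 (R \<circ> (erasure_channel n d \<phi>s \<circ> encoding V)) id v = sqrt h" "h \<le> 1"
    "\<And>t. t > 0 \<Longrightarrow> (Re (form dL TL x1 x1) - Re (form dL TL x2 x2)) / n
        \<le> (MAX i\<in>{..<n}. spread (T i)) / 2 * (t * (1 - h) + 4 / t)"
proof -
  define D where "D = total_dim n d"
  define \<tau> where "\<tau> = (MAX i\<in>{..<n}. spread (T i)) / 2"
  obtain m and K :: "nat \<Rightarrow> nat \<Rightarrow> nat \<Rightarrow> complex" where
    Kiso: "\<And>b b'. b < n * D \<Longrightarrow> b' < n * D \<Longrightarrow> (\<Sum>l<m. \<Sum>s<dL. cnj (K l s b) * K l s b') = (if b = b' then 1 else 0)"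
    and Kact: "\<And>X s s'. X \<in> carrier_mat (n * D) (n * D) \<Longrightarrow> s < dL \<Longrightarrow> s' < dL \<Longrightarrow>
       R X $$ (s, s') = (\<Sum>l<m. \<Sum>b<n * D. \<Sum>b'<n * D. K l s b * X $$ (b, b') * cnj (K l s' b'))"
    by (rule is_channelE[OF R[folded D_def]]) (rule that)
  let ?Sg = "Sigma {..<n} (\<lambda>i. {..<d i})"
  define y where "y x a = (\<Sum>q<dL. V $$ (a, q) * x q)" for x a
  define W where "W j b q = (case j of (i, k) \<Rightarrow> erased n d \<phi>s (\<lambda>a. V $$ (a, q)) i k b)" for j b q
  define \<Psi> where "\<Psi> x j s k = (case j of (l, i) \<Rightarrow> \<Sum>b<n * D. K l s b * erased n d \<phi>s (y x) i k b)" for x j s k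
  define w where "w j k = ((\<Sum>s<dL. cnj (x1 s) * \<Psi> x1 j s k) + (\<Sum>s<dL. cnj (x2 s) * \<Psi> x2 j s k)) / 2" for j k
  \<comment> \<open>\<open>k\<close> is kept out of this index set: its range depends on
    \<open>i\<close>, and it is the index on which the observable acts, block by block.\<close>
  define J where "J = {..<m} \<times> {..<n}"
  define dd where "dd j = d (snd j)" for j :: "nat \<times> nat"
  define h where "h = (\<Sum>j\<in>J. \<Sum>k<dd j. (cmod (w j k))\<^sup>2)"
  define KK where "KK p s q = (case p of (l, j) \<Rightarrow> \<Sum>b<n * D. K l s b * W j b q)" for p s q
  have sumJ: "(\<Sum>j\<in>J. f j) = (\<Sum>l<m. \<Sum>i<n. f (l, i))" for f :: "nat \<times> nat \<Rightarrow> 'z :: comm_monoid_add"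
    by (simp add: J_def sum.cartesian_product')
  have sumJ': "(\<Sum>j\<in>J. f j) = (\<Sum>i<n. \<Sum>l<m. f (l, i))" for f :: "nat \<times> nat \<Rightarrow> 'z :: comm_monoid_add"
    unfolding sumJ by (rule sum.swap)

  have kraus: "(R \<circ> (erasure_channel n d \<phi>s \<circ> encoding V)) X $$ (s, s')
      = (\<Sum>p\<in>{..<m} \<times> ?Sg. \<Sum>q<dL. \<Sum>q'<dL. KK p s q * X $$ (q, q') * cnj (KK p s' q'))"
    if X: "X \<in> carrier_mat dL dL" and s: "s < dL" "s' < dL" for X s s'
  proof -
    let ?Y = "erasure_channel n d \<phi>s (encoding V X)"
    have Y: "?Y \<in> carrier_mat (n * D) (n * D)" by (simp add: erasure_channel_def D_def)
    have "R ?Y $$ (s, s') = (\<Sum>l<m. \<Sum>b<n * D. \<Sum>b'<n * D. K l s b *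
        (\<Sum>j\<in>?Sg. \<Sum>q<dL. \<Sum>q'<dL. W j b q * X $$ (q, q') * cnj (W j b' q')) * cnj (K l s' b'))"
      unfolding Kact[OF Y s]
    proof (rule sum.cong[OF refl], rule sum.cong[OF refl], rule sum.cong[OF refl])
      fix l b b' assume "b \<in> {..<n * D}" "b' \<in> {..<n * D}"
      then have "?Y $$ (b, b') = (\<Sum>j\<in>?Sg. \<Sum>q<dL. \<Sum>q'<dL. W j b q * X $$ (q, q') * cnj (W j b' q'))"
        using erasure_encoding_index[OF d_pos V X, of b b' \<phi>s] by (simp add: D_def W_def case_prod_beta)
      then show "K l s b * ?Y $$ (b, b') * cnj (K l s' b') = K l s b *
        (\<Sum>j\<in>?Sg. \<Sum>q<dL. \<Sum>q'<dL. W j b q * X $$ (q, q') * cnj (W j b' q')) * cnj (K l s' b')"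
        by simp
    qed
    also have "\<dots> = (\<Sum>l<m. \<Sum>j\<in>?Sg. \<Sum>q<dL. \<Sum>q'<dL. KK (l, j) s q * X $$ (q, q') * cnj (KK (l, j) s' q'))"
      unfolding KK_def prod.case by (rule sum.cong[OF refl], rule kraus_compose)
    finally show ?thesis by (simp add: sum.cartesian_product')
  qed

  have KKx: "(\<Sum>q<dL. KK (l, (i, k)) s q * x q) = \<Psi> x (l, i) s k" for l i k s x
  proof -
    have "(\<Sum>q<dL. KK (l, (i, k)) s q * x q)
       = (\<Sum>q<dL. \<Sum>b<n * D. K l s b * (erased n d \<phi>s (\<lambda>a. V $$ (a, q)) i k b * x q))"
      by (simp add: KK_def W_def sum_distrib_right mult.assoc)
    also have "\<dots> = (\<Sum>b<n * D. K l s b * (\<Sum>q<dL. erased n d \<phi>s (\<lambda>a. V $$ (a, q)) i k b * x q))"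
      by (subst sum.swap) (simp add: sum_distrib_left)
    finally show ?thesis by (simp add: \<Psi>_def erased_linear y_def[abs_def])
  qed
  have half: "complex_of_real (sqrt 2) * of_real (sqrt 2) = 2"
    by (simp flip: of_real_mult)
  \<comment> \<open>The factor \<open>1 / sqrt 2\<close> in \<open>v\<close> enters once conjugated
    and once plain, so the two reference blocks contribute with weight one half each, which is the
    mean defining \<open>w\<close>.\<close>
  have overlap: "(\<Sum>r<2. \<Sum>s<dL. cnj (v $ (r * dL + s)) * (\<Sum>q<dL. KK (l, (i, k)) s q * v $ (r * dL + q)))
      = w (l, i) k" for l i k
  proof -
    have b: "(\<Sum>s<dL. cnj (u s) * (\<Sum>q<dL. KK (l, (i, k)) s q * u q))
        = (\<Sum>s<dL. cnj (x s) * \<Psi> x (l, i) s k) / 2"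
      if u: "\<And>s. s < dL \<Longrightarrow> u s = x s / of_real (sqrt 2)" for u x
    proof -
      have Ku: "(\<Sum>q<dL. KK (l, (i, k)) s q * u q) = \<Psi> x (l, i) s k / of_real (sqrt 2)" for s
        unfolding KKx[symmetric] sum_divide_distrib using u by (intro sum.cong) auto
      have "cnj (u s) * (\<Sum>q<dL. KK (l, (i, k)) s q * u q)
          = cnj (x s) * \<Psi> x (l, i) s k / (of_real (sqrt 2) * of_real (sqrt 2))" if "s < dL" for s
        unfolding Ku u[OF that] by simp
      then show ?thesis
        unfolding sum_divide_distrib half by (intro sum.cong) auto
    qed
    have "(\<Sum>r<2. \<Sum>s<dL. cnj (v $ (r * dL + s)) * (\<Sum>q<dL. KK (l, (i, k)) s q * v $ (r * dL + q)))
      = (\<Sum>s<dL. cnj (v $ s) * (\<Sum>q<dL. KK (l, (i, k)) s q * v $ q))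
        + (\<Sum>s<dL. cnj (v $ (dL + s)) * (\<Sum>q<dL. KK (l, (i, k)) s q * v $ (dL + q)))"
      by (simp add: numeral_2_eq_2)
    also have "\<dots> = w (l, i) k"
      unfolding w_def add_divide_distrib
      by (rule arg_cong2[where f = "(+)"]; rule b; rule v; assumption)
    finally show ?thesis .
  qed
  have fid: "ent_fidelity dL 2 (R \<circ> (erasure_channel n d \<phi>s \<circ> encoding V)) id v = sqrt h"
  proof -
    have "(\<Sum>p\<in>{..<m} \<times> ?Sg. (cmod (\<Sum>r<2. \<Sum>s<dL. cnj (v $ (r * dL + s)) * (\<Sum>q<dL. KK p s q * v $ (r * dL + q))))\<^sup>2)
       = (\<Sum>l<m. \<Sum>(i, k)\<in>?Sg. (cmod (w (l, i) k))\<^sup>2)"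
      unfolding sum.cartesian_product' using overlap by (intro sum.cong refl) auto
    also have "\<dots> = (\<Sum>l<m. \<Sum>i<n. \<Sum>k<d i. (cmod (w (l, i) k))\<^sup>2)"
      by (rule sum.cong[OF refl], subst sum.Sigma) auto
    also have "\<dots> = h" by (simp add: h_def sumJ dd_def)
    finally show ?thesis
      using ent_fidelity_kraus[OF kraus v(1,2)] by (simp only:)
  qed

  have env: "(\<Sum>l<m. \<Sum>s<dL. form (d i) G (\<Psi> x (l, i) s) (\<Psi> x (l, i) s))
      = form D (embed_local n d i G) (y x) (y x) / of_nat n" if i: "i < n" for i G x
    unfolding D_def
    by (rule environment_form[where n = n and d = d and \<phi>s = \<phi>s and i = i and R = K and y = "y x" and \<Psi> = "\<lambda>l. \<Psi> x (l, i)",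
          OF d_pos i phi_unit[rule_format, OF i]])
       (simp_all add: Kiso[unfolded D_def] \<Psi>_def D_def)
  have ipy: "ip D (y x) (y x) = ip dL x x" for x
    using ip_isometry[OF V V_iso, of x] by (simp add: D_def y_def[abs_def])
  \<comment> \<open>Taking \<open>G\<close> to be the identity in \<open>env\<close> shows that each
    lost subsystem has probability \<open>1/n\<close>.\<close>
  have norm: "(\<Sum>j\<in>J. \<Sum>s<dL. \<Sum>k<dd j. (cmod (\<Psi> x j s k))\<^sup>2) = 1" if "ip dL x x = 1" for x
  proof -
    have "complex_of_real (\<Sum>j\<in>J. \<Sum>s<dL. \<Sum>k<dd j. (cmod (\<Psi> x j s k))\<^sup>2)
      = (\<Sum>i<n. \<Sum>l<m. \<Sum>s<dL. form (d i) (1\<^sub>m (d i)) (\<Psi> x (l, i) s) (\<Psi> x (l, i) s))"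
      unfolding sumJ' form_one ip_self by (simp add: dd_def)
    also have "\<dots> = (\<Sum>i<n. 1 / of_nat n)"
      using env form_embed_local_one[OF d_pos] ipy that by (intro sum.cong refl) (simp add: D_def)
    also have "\<dots> = 1" using n_pos by simp
    finally show ?thesis unfolding of_real_eq_1_iff .
  qed

  \<comment> \<open>Subtracting the midpoint of the spectrum makes the extreme eigenvalues opposite,
    so the form is bounded by half the spread times the squared norm.\<close>
  define mid where "mid i = (max_eig (T i) + min_eig (T i)) / 2" for i
  define S where "S j = of_real 1 \<cdot>\<^sub>m T (snd j) + of_real (- mid (snd j)) \<cdot>\<^sub>m 1\<^sub>m (dd j)" for j :: "nat \<times> nat"
  have Sc: "S j \<in> carrier_mat (dd j) (dd j)" "hermitian_mat (S j)" if "j \<in> J" for j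
  proof -
    have "T (snd j) \<in> carrier_mat (dd j) (dd j)" "hermitian_mat (T (snd j))"
      using that T by (auto simp: J_def dd_def)
    then show "S j \<in> carrier_mat (dd j) (dd j)" "hermitian_mat (S j)"
      unfolding S_def by (simp, intro hermitian_affine)
  qed
  have Sf: "form (d i) (S (l, i)) u u = form (d i) (T i) u u - of_real (mid i) * ip (d i) u u" if "i < n" for l i u
    using form_affine[of "T i" "d i" 1 "of_real (- mid i)" u u] T that by (simp add: S_def dd_def)
  have bound: "\<bar>Re (form (dd j) (S j) u u)\<bar> \<le> \<tau> * Re (ip (dd j) u u)" if "j \<in> J" for j u
  proof -
    obtain l i where j: "j = (l, i)" "i < n" using \<open>j \<in> J\<close> by (auto simp: J_def)
    have Ti: "T i \<in> carrier_mat (d i) (d i)" "hermitian_mat (T i)" "0 < d i" using T d_pos j by auto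
    have "\<bar>Re (form (d i) (S (l, i)) u u)\<bar> \<le> spread (T i) / 2 * Re (ip (d i) u u)"
    proof -
      have "Re (form (d i) (S (l, i)) u u) = Re (form (d i) (T i) u u) - mid i * Re (ip (d i) u u)"
        by (simp add: Sf[OF j(2)])
      moreover have "spread (T i) / 2 * z = max_eig (T i) * z - mid i * z"
        "spread (T i) / 2 * z = mid i * z - min_eig (T i) * z" for z
        by (simp_all add: spread_def mid_def field_simps)
      ultimately show ?thesis
        using rayleigh_bounds[OF Ti, of u] by (metis abs_le_iff diff_right_mono diff_left_mono minus_diff_eq)
    qed
    also have "\<dots> \<le> \<tau> * Re (ip (d i) u u)"
      unfolding \<tau>_def using j by (intro mult_right_mono divide_right_mono ip_self_nonneg) auto
    finally show ?thesis by (simp add: j dd_def)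
  qed
  have \<tau>: "\<tau> \<ge> 0"
  proof -
    have "0 \<le> spread (T 0)" using spread_nonneg[of "T 0" "d 0"] T d_pos n_pos by auto
    also have "\<dots> \<le> (MAX i\<in>{..<n}. spread (T i))" using n_pos by (intro Max_ge) auto
    finally show ?thesis by (simp add: \<tau>_def)
  qed
  have TA: "TA \<in> carrier_mat D D"
    unfolding TA_def D_def by (rule msum_carrier) (auto simp: embed_local_carrier)
  \<comment> \<open>The offset from the midpoints is the same for every unit input and cancels when
    two inputs are compared.\<close>
  have energy: "(\<Sum>j\<in>J. \<Sum>s<dL. Re (form (dd j) (S j) (\<Psi> x j s) (\<Psi> x j s)))
      = (Re (form dL TL x x) - (\<Sum>i<n. mid i)) / n" if xx: "ip dL x x = 1" for x
  proof -
    have "(\<Sum>j\<in>J. \<Sum>s<dL. form (dd j) (S j) (\<Psi> x j s) (\<Psi> x j s))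
      = (\<Sum>i<n. (form D (embed_local n d i (T i)) (y x) (y x) - of_real (mid i)) / of_nat n)"
      unfolding sumJ'
    proof (rule sum.cong[OF refl])
      fix i assume "i \<in> {..<n}"
      then have i: "i < n" by simp
      have "(\<Sum>l<m. \<Sum>s<dL. form (dd (l, i)) (S (l, i)) (\<Psi> x (l, i) s) (\<Psi> x (l, i) s))
         = (\<Sum>l<m. \<Sum>s<dL. form (d i) (T i) (\<Psi> x (l, i) s) (\<Psi> x (l, i) s))
           - of_real (mid i) * (\<Sum>l<m. \<Sum>s<dL. form (d i) (1\<^sub>m (d i)) (\<Psi> x (l, i) s) (\<Psi> x (l, i) s))"
        by (simp add: dd_def Sf[OF i] form_one sum_subtractf sum_distrib_left)
      also have "\<dots> = (form D (embed_local n d i (T i)) (y x) (y x) - of_real (mid i)) / of_nat n"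
        unfolding env[OF i] using form_embed_local_one[OF d_pos i] ipy xx
        by (simp add: D_def diff_divide_distrib)
      finally show "(\<Sum>l<m. \<Sum>s<dL. form (dd (l, i)) (S (l, i)) (\<Psi> x (l, i) s) (\<Psi> x (l, i) s))
         = (form D (embed_local n d i (T i)) (y x) (y x) - of_real (mid i)) / of_nat n" .
    qed
    also have "\<dots> = ((\<Sum>i<n. form D (embed_local n d i (T i)) (y x) (y x)) - of_real (\<Sum>i<n. mid i)) / of_nat n"
      by (simp add: sum_subtractf flip: sum_divide_distrib)
    also have "(\<Sum>i<n. form D (embed_local n d i (T i)) (y x) (y x)) = form D TA (y x) (y x)"
      unfolding TA_def D_def by (rule form_msum[symmetric]) (rule embed_local_carrier)
    also have "\<dots> = form dL TL x x"
      unfolding covariant[symmetric] y_def[abs_def] by (rule form_conjugate[symmetric, OF V[folded D_def] TA])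
    finally have "Re (\<Sum>j\<in>J. \<Sum>s<dL. form (dd j) (S j) (\<Psi> x j s) (\<Psi> x j s))
      = Re ((form dL TL x x - of_real (\<Sum>i<n. mid i)) / of_nat n)" by simp
    then show ?thesis by (simp add: Re_divide_of_nat)
  qed
  note dist = environment_distinguishability[where J = J and m = dd and S = S and \<tau> = \<tau> and e = dL
      and ?x1.0 = x1 and ?x2.0 = x2 and ?\<Psi>1.0 = "\<Psi> x1" and ?\<Psi>2.0 = "\<Psi> x2" and w = w and h = h,
      OF _ Sc bound \<tau> x norm[OF x(1)] norm[OF x(2)] w_def h_def]
  have "finite J" by (simp add: J_def)
  show thesis
  proof (rule that[OF fid dist(1)[OF \<open>finite J\<close>]])
    fix t :: real assume "t > 0"
    from dist(2)[OF \<open>finite J\<close> _ _ _ this]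
    show "(Re (form dL TL x1 x1) - Re (form dL TL x2 x2)) / n
        \<le> (MAX i\<in>{..<n}. spread (T i)) / 2 * (t * (1 - h) + 4 / t)"
      unfolding energy[OF x(1)] energy[OF x(2)] \<tau>_def by (simp add: diff_divide_distrib)
  qed
qed

section \<open>Test state, choice of the parameter and the final bound\<close>

lemma pure_superposition:
  assumes x: "ip m x1 x1 = 1" "ip m x2 x2 = 1"
  obtains v where "v \<in> unit_vec_set (2 * m)" "ip (2 * m) (vec_index v) (vec_index v) = 1"
    "\<And>s. s < m \<Longrightarrow> v $ s = x1 s / of_real (sqrt 2)" "\<And>s. s < m \<Longrightarrow> v $ (m + s) = x2 s / of_real (sqrt 2)"
proof -
  \<comment> \<open>The reference qubit flags the two branches and makes them orthogonal, so the
    vector is normalised whatever the overlap of \<open>x1\<close> and \<open>x2\<close>.\<close>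
  define v where "v = vec (2 * m) (\<lambda>a. (if a < m then x1 a else x2 (a - m)) / of_real (sqrt 2))"
  have v: "v \<in> carrier_vec (2 * m)" by (simp add: v_def)
  have v1: "v $ s = x1 s / of_real (sqrt 2)" and v2: "v $ (m + s) = x2 s / of_real (sqrt 2)" if "s < m" for s
    using that by (simp_all add: v_def)
  have half: "complex_of_real (sqrt 2) * of_real (sqrt 2) = 2"
    by (simp flip: of_real_mult)
  have "ip (2 * m) (vec_index v) (vec_index v)
    = (\<Sum>s<m. cnj (v $ s) * v $ s) + (\<Sum>s<m. cnj (v $ (m + s)) * v $ (m + s))"
    unfolding ip_def sum_blocks by (simp add: numeral_2_eq_2)
  also have "\<dots> = (\<Sum>s<m. cnj (x1 s) * x1 s / 2) + (\<Sum>s<m. cnj (x2 s) * x2 s / 2)"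
    using half by (intro arg_cong2[where f = "(+)"] sum.cong refl) (simp_all add: v1 v2)
  also have "\<dots> = 1"
    using x by (simp add: ip_def flip: sum_divide_distrib)
  finally have i: "ip (2 * m) (vec_index v) (vec_index v) = 1" .
  have "v \<bullet>c v = 1"
    using i v by (simp add: scalar_prod_def ip_def atLeast0LessThan mult.commute)
  then show thesis using that[of v] v i v1 v2 by (simp add: unit_vec_set_def)
qed

lemma quadratic_tradeoff:
  fixes \<delta> \<tau> h :: real
  assumes t: "\<And>t. t > 0 \<Longrightarrow> 4 * \<tau> * \<epsilon> \<le> \<tau> * (t * (1 - h) + 4 / t)" and "\<tau> > 0" "h \<le> 1" "\<epsilon> \<ge> 0"
  shows "h \<le> 1 - \<epsilon>\<^sup>2"
proof (cases "\<epsilon> = 0")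
  case False
  then have e: "\<epsilon> > 0" using assms by simp
  \<comment> \<open>The best \<open>t\<close> is \<open>2 / sqrt (1 - h)\<close>. Inserting its
    value at the intended equality \<open>1 - h = \<epsilon>\<^sup>2\<close> also covers
    \<open>h = 1\<close>, where no best \<open>t\<close> exists.\<close>
  then have "\<tau> * (4 * \<epsilon>) \<le> \<tau> * (2 / \<epsilon> * (1 - h) + 4 / (2 / \<epsilon>))"
    using t[of "2 / \<epsilon>"] by (simp add: mult_ac)
  then have "4 * \<epsilon> \<le> 2 / \<epsilon> * (1 - h) + 2 * \<epsilon>"
    using \<open>\<tau> > 0\<close> by (simp add: mult_le_cancel_left_pos)
  then have "\<epsilon> \<le> (1 - h) / \<epsilon>" using e by (simp add: field_simps)
  then show ?thesis using e by (simp add: pos_le_divide_eq power2_eq_square)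
qed (use assms in simp)

theorem theorem1:
  fixes n dL :: nat and d :: "nat \<Rightarrow> nat" and V TL TA :: "complex mat"
    and T :: "nat \<Rightarrow> complex mat" and \<phi>s :: "nat \<Rightarrow> complex vec"
  assumes n_pos: "0 < n"
    and dL_pos: "0 < dL"
    and d_pos: "\<forall>i<n. 0 < d i"
    and V_dim: "V \<in> carrier_mat (total_dim n d) dL"
    and V_iso: "mat_adjoint V * V = 1\<^sub>m dL"
    and TL_dim: "TL \<in> carrier_mat dL dL"
    and TL_herm: "hermitian_mat TL"
    and T_dim: "\<forall>i<n. T i \<in> carrier_mat (d i) (d i)"
    and T_herm: "\<forall>i<n. hermitian_mat (T i)"
    and TA_def: "TA = msum (total_dim n d) (map (\<lambda>i. embed_local n d i (T i)) [0..<n])"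
    and commute: "TA * (V * mat_adjoint V) = (V * mat_adjoint V) * TA"
    and covariant: "mat_adjoint V * TA * V = TL"
    and symm_spec: "\<forall>i<n. \<bar>max_eig (T i)\<bar> = \<bar>min_eig (T i)\<bar>"
    and phi_unit: "\<forall>i<n. \<phi>s i \<in> unit_vec_set (d i)"
  shows "eps_worst dL (n * total_dim n d) (erasure_channel n d \<phi>s \<circ> encoding V)
           \<ge> 1 / (2 * real n) * (spread TL / (MAX i\<in>{..<n}. spread (T i)))"
proof -
  define MX where "MX = (MAX i\<in>{..<n}. spread (T i))"
  define \<epsilon> where "\<epsilon> = 1 / (2 * real n) * (spread TL / MX)"
  define M where "M = erasure_channel n d \<phi>s \<circ> encoding V"
  define B where "B = n * total_dim n d"
  define P where "P = {(dR :: nat, \<phi>). 0 < dR \<and> \<phi> \<in> unit_vec_set (dR * dL)}"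
  define F where "F R = (INF p\<in>P. ent_fidelity dL (fst p) (R \<circ> M) id (snd p))" for R
  have MX: "MX \<ge> 0"
  proof -
    have "0 \<le> spread (T 0)" using spread_nonneg[of "T 0" "d 0"] T_dim T_herm d_pos n_pos by auto
    also have "\<dots> \<le> MX" unfolding MX_def using n_pos by (intro Max_ge) auto
    finally show ?thesis .
  qed
  have eps: "\<epsilon> \<ge> 0"
    unfolding \<epsilon>_def using MX spread_nonneg[OF TL_dim TL_herm dL_pos] by simp
  obtain x1 where x1: "ip dL x1 x1 = 1" "form dL TL x1 x1 = of_real (max_eig TL)"
    by (rule extremal_eigenvector[OF TL_dim TL_herm extremal_eigenvalues(1)[OF TL_dim TL_herm dL_pos]])
  obtain x2 where x2: "ip dL x2 x2 = 1" "form dL TL x2 x2 = of_real (min_eig TL)"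
    by (rule extremal_eigenvector[OF TL_dim TL_herm extremal_eigenvalues(2)[OF TL_dim TL_herm dL_pos]])
  obtain v where v: "v \<in> unit_vec_set (2 * dL)" "ip (2 * dL) (vec_index v) (vec_index v) = 1"
    "\<And>s. s < dL \<Longrightarrow> v $ s = x1 s / of_real (sqrt 2)" "\<And>s. s < dL \<Longrightarrow> v $ (dL + s) = x2 s / of_real (sqrt 2)"
    by (rule pure_superposition[OF x1(1) x2(1)]) (rule that)
  have vc: "v \<in> carrier_vec (2 * dL)" using v(1) by (simp add: unit_vec_set_def)
  have vP: "(2, v) \<in> P" using v(1) by (simp add: P_def)
  have nonneg: "0 \<le> ent_fidelity dL (fst p) (R \<circ> M) id (snd p)" for p R
    by (simp add: ent_fidelity_def fidelity_nonneg)
  have F_nonneg: "0 \<le> F R" for R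
    unfolding F_def using vP nonneg by (intro cINF_greatest) auto
  have key: "(F R)\<^sup>2 \<le> 1 - \<epsilon>\<^sup>2" if R: "is_channel B dL R" for R
  proof -
    obtain h where h': "ent_fidelity dL 2 (R \<circ> (erasure_channel n d \<phi>s \<circ> encoding V)) id v = sqrt h" "h \<le> 1"
      "\<And>t. t > 0 \<Longrightarrow> (Re (form dL TL x1 x1) - Re (form dL TL x2 x2)) / n
         \<le> (MAX i\<in>{..<n}. spread (T i)) / 2 * (t * (1 - h) + 4 / t)"
      by (rule covariant_code_fidelity[OF n_pos d_pos V_dim V_iso T_dim T_herm TA_def covariant phi_unit
            x1(1) x2(1) R[unfolded B_def] vc v(2-4)]) (assumption+, rule that)
    note h = h'[folded M_def MX_def]
    have h0: "h \<ge> 0" using nonneg[of "(2, v)" R] h(1) by simp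
    have "h \<le> 1 - \<epsilon>\<^sup>2"
    \<comment> \<open>Division by zero yields zero, so in the first case \<open>\<epsilon>\<close>
      vanishes and the claim is just \<open>h \<le> 1\<close>.\<close>
    proof (cases "MX = 0")
      case True
      then show ?thesis using h(2) by (simp add: \<epsilon>_def)
    next
      case False
      then have pos: "MX / 2 > 0" using MX by simp
      show ?thesis
      proof (rule quadratic_tradeoff[OF _ pos h(2) eps])
        fix t :: real assume "t > 0"
        \<comment> \<open>\<open>\<epsilon>\<close> is the charge gap over
          \<open>2 * n * MX\<close>, so this product is the gap divided by \<open>n\<close>; the 4
          matches the infimum \<open>4 * sqrt (1 - h)\<close> over \<open>t\<close>.\<close>
        moreover have "4 * (MX / 2) * \<epsilon> = (max_eig TL - min_eig TL) / n"
          using False by (simp add: \<epsilon>_def spread_def)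
        ultimately show "4 * (MX / 2) * \<epsilon> \<le> MX / 2 * (t * (1 - h) + 4 / t)"
          using h(3)[of t] x1(2) x2(2) by simp
      qed
    qed
    moreover have "F R \<le> sqrt h"
    proof -
      \<comment> \<open>A real infimum is known to lie below its members only when the set is
        bounded below; nonnegativity of fidelity supplies this.\<close>
      have "bdd_below ((\<lambda>p. ent_fidelity dL (fst p) (R \<circ> M) id (snd p)) ` P)"
        using nonneg by (intro bdd_belowI2)
      from cINF_lower[OF this vP] show ?thesis using h(1) by (simp add: F_def)
    qed
    then have "(F R)\<^sup>2 \<le> h"
      using F_nonneg[of R] h0 by (metis power_mono real_sqrt_pow2)
    ultimately show ?thesis by linarith
  qed
  obtain R0 where R0: "is_channel B dL R0" using is_channel_exists[OF dL_pos] by blast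
  have fw: "f_worst dL B M = (SUP R\<in>{R. is_channel B dL R}. F R)"
    by (simp add: f_worst_def F_def P_def)
  have le: "F R \<le> sqrt (1 - \<epsilon>\<^sup>2)" if "is_channel B dL R" for R
    using key[OF that] by (rule real_le_rsqrt)
  have "f_worst dL B M \<le> sqrt (1 - \<epsilon>\<^sup>2)"
    unfolding fw using R0 le by (intro cSUP_least) auto
  \<comment> \<open>Both this and the nonnegativity of \<open>1 - \<epsilon>\<^sup>2\<close> are
    needed to square the upper bound on \<open>f_worst\<close>; each uses that some recovery
    exists.\<close>
  moreover have "0 \<le> f_worst dL B M"
  proof -
    have "bdd_above (F ` {R. is_channel B dL R})" using le by (intro bdd_aboveI2) auto
    then have "F R0 \<le> f_worst dL B M" unfolding fw using R0 by (intro cSUP_upper) auto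
    then show ?thesis using F_nonneg[of R0] by linarith
  qed
  moreover have "0 \<le> 1 - \<epsilon>\<^sup>2" using key[OF R0] by (rule order_trans[OF zero_le_power2])
  ultimately have "(f_worst dL B M)\<^sup>2 \<le> 1 - \<epsilon>\<^sup>2"
    by (metis power_mono real_sqrt_pow2)
  then have "\<epsilon>\<^sup>2 \<le> 1 - (f_worst dL B M)\<^sup>2" by simp
  then have "\<epsilon> \<le> eps_worst dL B M"
    unfolding eps_worst_def by (rule real_le_rsqrt)
  then show ?thesis by (simp add: \<epsilon>_def MX_def M_def B_def)
qed

end
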